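(* Let $f_j$ be nonnegative measurable functions on $\mathbb{R}^n$ vanishing at infinity. (i) If $A=(a_{ij})\in\mathrm{GL}_n(\mathbb{R})$, then $$\operatorname*{ess\,sup}_{y_1,\dots,y_n}\prod_{j=1}^{n}f_j^*\Big(\sum_{i=1}^{n}a_{ij}y_i\Big)\det(0,y_1,\dots,y_n)\le\operatorname*{ess\,sup}_{y_1,\dots,y_n}\prod_{j=1}^{n}f_j\Big(\sum_{i=1}^{n}a_{ij}y_i\Big)\det(0,y_1,\dots,y_n).$$ (ii) If $A=(a_{ij})\in\mathrm{GL}_{n+1}(\mathbb{R})$, then $$\operatorname*{ess\,sup}_{y_1,\dots,y_{n+1}}\prod_{j=1}^{n+1}f_j^*\Big(\sum_{i=1}^{n+1}a_{ij}y_i\Big)\det(y_1,\dots,y_{n+1})\le\operatorname*{ess\,sup}_{y_1,\dots,y_{n+1}}\prod_{j=1}^{n+1}f_j\Big(\sum_{i=1}^{n+1}a_{ij}y_i\Big)\det(y_1,\dots,y_{n+1}).$$ (All $y_i$ range over $\mathbb{R}^n$.) In particular, with $A=I$, $\operatorname{ess\,sup}\prod_{j=1}^n f_j^*(y_j)\det(0,y_1,\dots,y_n)\le\operatorname{ess\,sup}\prod_{j=1}^nf_j(y_j)\det(0,y_1,\dots,y_n)$ and similarly for $\det(y_1,\dots,y_{n+1})$.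
   Context: A nonnegative measurable function $f$ on $\mathbb{R}^n$ vanishes at infinity if $|\{x:f(x)>t\}|<\infty$ for every $t>0$. For a measurable set $A\subset\mathbb{R}^n$ of finite measure, $A^*$ is the open ball centred at $0$ with $|A^*|=|A|$; the symmetric decreasing rearrangement of $f$ is $f^*(x)=\int_0^\infty\chi_{\{f>t\}^*}(x)\,dt$. For $y_1,\dots,y_n\in\mathbb{R}^n$, $\det(0,y_1,\dots,y_n)=|\det M|$ with $M$ the matrix with columns $y_1,\dots,y_n$; for $y_1,\dots,y_{n+1}\in\mathbb{R}^n$, $\det(y_1,\dots,y_{n+1})$ is the absolute value of the determinant of the matrix with columns $y_1-y_{n+1},\dots,y_n-y_{n+1}$. ess sup denotes the essential supremum with respect to Lebesgue measure on the product space. *)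

theory Defs
  imports "HOL-Analysis.Analysis" "HOL-Probability.Essential_Supremum"
begin

definition vanishes_at_infinity :: "('a::euclidean_space \<Rightarrow> ennreal) \<Rightarrow> bool" where
  "vanishes_at_infinity f \<longleftrightarrow>
     (\<forall>t::real. t > 0 \<longrightarrow> emeasure lebesgue {x. f x > ennreal t} < \<infinity>)"

text \<open>A^*: the open ball centred at 0 with the same Lebesgue measure as A
  (meaningful for sets of finite measure; the empty ball is ball 0 0).\<close>
definition sym_set :: "'a::euclidean_space set \<Rightarrow> 'a set" where
  "sym_set A = ball 0 (SOME r. r \<ge> 0 \<and> emeasure lebesgue (ball (0::'a) r) = emeasure lebesgue A)"

definition sym_rearr :: "('a::euclidean_space \<Rightarrow> ennreal) \<Rightarrow> 'a \<Rightarrow> ennreal" where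
  "sym_rearr f x = (\<integral>\<^sup>+ t\<in>{0<..}. indicator (sym_set {y. f y > ennreal t}) x \<partial>lborel)"

definition det0 :: "(real^'n)^'n \<Rightarrow> real" where
  "det0 y = \<bar>det (\<chi> k i. y $ i $ k :: real^'n^'n)\<bar>"

text \<open>det(y_1,...,y_{n+1}): the (n+1)-st point is indexed by None, the others by Some i;
  |det M| where M has columns y_i - y_{n+1}.\<close>
definition det1 :: "(real^'n)^('n option) \<Rightarrow> real" where
  "det1 y = \<bar>det (\<chi> k i. (y $ Some i - y $ None) $ k :: real^'n^'n)\<bar>"

end

theory Submission
  imports Defs
begin

text \<open>Both determinants are, for every unit vector \<open>v\<close>, linear in the tuple of components of the points along
  \<open>v\<close>, and this survives any linear change among the points. Hence a bound \<open>\<bar>D\<bar> \<le> c\<close> on a product of sets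
  persists when all sets are Steiner symmetrized in one direction. If some set \<open>E\<close> is not yet the ball \<open>B\<close>,
  averaging over translations yields a vector \<open>w\<close> such that a substantial part of \<open>E - B\<close> is carried into \<open>B - E\<close>;
  symmetrizing along \<open>w\<close> increases the measure of \<open>E \<inter> B\<close> by at least that part. So the sets can be brought
  arbitrarily close in measure to the balls, and the bound passes to the balls by continuity of \<open>D\<close>.
  The statement for functions follows by applying this to superlevel sets.\<close>

section \<open>Steiner symmetrization\<close>

definition line_measure :: "'a::euclidean_space set \<Rightarrow> 'a \<Rightarrow> 'a \<Rightarrow> ennreal" where
  "line_measure E v x = emeasure lborel {t::real. x + t *\<^sub>R v \<in> E}"

text \<open>On each line parallel to the unit vector \<open>v\<close>, the section of
  \<open>E\<close> becomes the open segment of the same length centred on the hyperplane orthogonal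
  to \<open>v\<close>. For Borel \<open>E\<close> the length is the same from every point of the
  line, so \<open>x\<close> itself serves as base point.\<close>

definition steiner :: "'a::euclidean_space \<Rightarrow> 'a set \<Rightarrow> 'a set" where
  "steiner v E = {x. ennreal (2 * \<bar>x \<bullet> v\<bar>) < line_measure E v x}"

lemma borel_line_section [measurable]:
  fixes E :: "'a::euclidean_space set"
  assumes "E \<in> sets borel"
  shows "{t::real. x + t *\<^sub>R v \<in> E} \<in> sets borel"
proof -
  have "(\<lambda>t::real. x + t *\<^sub>R v) -` E \<inter> space borel \<in> sets borel"
    by (rule measurable_sets[OF _ assms]) simp
  then show ?thesis by (simp add: vimage_def)
qed

lemma line_measure_nn_integral:
  fixes E :: "'a::euclidean_space set"
  assumes "E \<in> sets borel"
  shows "line_measure E v x = (\<integral>\<^sup>+t. indicator E (x + t *\<^sub>R v) \<partial>lborel)"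
proof -
  have "(\<integral>\<^sup>+t. indicator E (x + t *\<^sub>R v) \<partial>lborel) = (\<integral>\<^sup>+t. indicator {t. x + t *\<^sub>R v \<in> E} t \<partial>lborel)"
    by (intro nn_integral_cong) (simp add: indicator_def)
  then show ?thesis
    using borel_line_section[OF assms] by (simp add: line_measure_def)
qed

lemma borel_measurable_line_measure [measurable]:
  fixes E :: "'a::euclidean_space set"
  assumes [measurable]: "E \<in> sets borel"
  shows "line_measure E v \<in> borel_measurable borel"
proof -
  have "line_measure E v = (\<lambda>x. \<integral>\<^sup>+t. indicator E (x + t *\<^sub>R v) \<partial>lborel)"
    using line_measure_nn_integral[OF assms] by auto
  moreover have "\<dots> \<in> borel_measurable borel"
    by measurable
  ultimately show ?thesis by simp
qed

lemma borel_steiner [measurable]: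
  fixes E :: "'a::euclidean_space set"
  assumes [measurable]: "E \<in> sets borel"
  shows "steiner v E \<in> sets borel"
  unfolding steiner_def by measurable

lemma nn_integral_lborel_translate:
  fixes f :: "'a::euclidean_space \<Rightarrow> ennreal"
  assumes [measurable]: "f \<in> borel_measurable borel"
  shows "(\<integral>\<^sup>+x. f (c + x) \<partial>lborel) = (\<integral>\<^sup>+x. f x \<partial>lborel)"
  by (subst (2) lborel_distr_plus[of c, symmetric]) (simp add: nn_integral_distr)

lemma emeasure_lborel_translate:
  fixes S :: "'a::euclidean_space set"
  assumes "S \<in> sets borel"
  shows "emeasure lborel {x. c + x \<in> S} = emeasure lborel S"
proof -
  have "emeasure lborel S = emeasure (distr lborel borel ((+) c)) S"
    by (simp add: lborel_distr_plus)
  also have "\<dots> = emeasure lborel {x. c + x \<in> S}"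
    using assms by (simp add: emeasure_distr vimage_def)
  finally show ?thesis by simp
qed

text \<open>Fubini along the lines parallel to \<open>v\<close>, free of coordinates: the slab \<open>0 \<le> x \<bullet> v \<le> 1\<close>
  meets each of these lines in a segment of length 1.\<close>
lemma emeasure_eq_integral_line_measure:
  fixes E :: "'a::euclidean_space set"
  assumes E [measurable]: "E \<in> sets borel" and v: "norm v = 1"
  shows "emeasure lborel E = (\<integral>\<^sup>+x. indicator {0..1} (x \<bullet> v) * line_measure E v x \<partial>lborel)"
proof -
  have vv: "v \<bullet> v = 1"
    using v by (simp add: dot_square_norm)
  have "(\<integral>\<^sup>+x. indicator {0..1} (x \<bullet> v) * line_measure E v x \<partial>lborel)
      = (\<integral>\<^sup>+x. (\<integral>\<^sup>+t. indicator {0..1} (x \<bullet> v) * indicator E (x + t *\<^sub>R v) \<partial>lborel) \<partial>lborel)"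
    by (simp add: line_measure_nn_integral nn_integral_cmult)
  also have "\<dots> = (\<integral>\<^sup>+t. (\<integral>\<^sup>+x. indicator {0..1} (x \<bullet> v) * indicator E (x + t *\<^sub>R v) \<partial>lborel) \<partial>lborel)"
    by (rule lborel_pair.Fubini'[symmetric]) measurable
  also have "\<dots> = (\<integral>\<^sup>+t. (\<integral>\<^sup>+x. indicator {0..1} (x \<bullet> v - t) * indicator E x \<partial>lborel) \<partial>lborel)"
  proof (rule nn_integral_cong)
    fix t :: real
    have "(\<integral>\<^sup>+x. indicator {0..1} (x \<bullet> v - t) * indicator E x \<partial>lborel)
       = (\<integral>\<^sup>+x. indicator {0..1} ((t *\<^sub>R v + x) \<bullet> v - t) * indicator E (t *\<^sub>R v + x) \<partial>lborel)"
      by (rule nn_integral_lborel_translate[symmetric]) measurable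
    then show "(\<integral>\<^sup>+x. indicator {0..1} (x \<bullet> v) * indicator E (x + t *\<^sub>R v) \<partial>lborel)
       = (\<integral>\<^sup>+x. indicator {0..1} (x \<bullet> v - t) * indicator E x \<partial>lborel)"
      by (simp add: inner_add_left vv add.commute)
  qed
  also have "\<dots> = (\<integral>\<^sup>+x. (\<integral>\<^sup>+t. indicator {0..1} (x \<bullet> v - t) * indicator E x \<partial>lborel) \<partial>lborel)"
    by (rule lborel_pair.Fubini') measurable
  also have "\<dots> = (\<integral>\<^sup>+x. indicator E x \<partial>lborel)"
  proof (rule nn_integral_cong)
    fix x :: 'a
    have "(\<integral>\<^sup>+t. indicator {0..1} (x \<bullet> v - t) \<partial>lborel)
        = (\<integral>\<^sup>+t. indicator {x \<bullet> v - 1..x \<bullet> v} t \<partial>(lborel::real measure))"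
      by (intro nn_integral_cong) (auto simp: indicator_def)
    then show "(\<integral>\<^sup>+t. indicator {0..1} (x \<bullet> v - t) * indicator E x \<partial>lborel) = indicator E x"
      by (simp add: nn_integral_multc)
  qed
  finally show ?thesis by simp
qed

lemma line_measure_shift:
  fixes E :: "'a::euclidean_space set"
  assumes "E \<in> sets borel"
  shows "line_measure E v (x + t *\<^sub>R v) = line_measure E v x"
proof -
  have "{s. (x + t *\<^sub>R v) + s *\<^sub>R v \<in> E} = {s. t + s \<in> {s. x + s *\<^sub>R v \<in> E}}"
    by (auto simp: algebra_simps)
  then show ?thesis
    using emeasure_lborel_translate[OF borel_line_section[OF assms]] by (simp add: line_measure_def)
qed

lemma line_measure_mono:
  fixes E F :: "'a::euclidean_space set"
  assumes "E \<subseteq> F" "F \<in> sets borel"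
  shows "line_measure E v x \<le> line_measure F v x"
  unfolding line_measure_def by (rule emeasure_mono) (use assms borel_line_section in auto)

text \<open>With \<open>a = x \<bullet> v\<close> and \<open>L\<close> the length of the section of
  \<open>E\<close>, this set is the section of the symmetral: an open interval about
  \<open>- a\<close>, or the whole line when \<open>L\<close> is infinite.\<close>

lemma emeasure_centred_interval:
  fixes a :: real
  shows "emeasure lborel {t. ennreal (2 * \<bar>a + t\<bar>) < L} = L"
proof (cases L)
  case (real l)
  have "{t. ennreal (2 * \<bar>a + t\<bar>) < L} = {-a-l/2<..<-a+l/2}"
    using real by (auto simp: ennreal_less_iff abs_if field_simps split: if_splits)
  then show ?thesis using real by simp
next
  case top
  then have "{t. ennreal (2 * \<bar>a + t\<bar>) < L} = UNIV" by auto
  then show ?thesis using top by simp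
qed

lemma mem_steiner_line:
  fixes E :: "'a::euclidean_space set"
  assumes "E \<in> sets borel" "norm v = 1"
  shows "x + t *\<^sub>R v \<in> steiner v E \<longleftrightarrow> ennreal (2 * \<bar>x \<bullet> v + t\<bar>) < line_measure E v x"
proof -
  have "v \<bullet> v = 1"
    using assms by (simp add: dot_square_norm)
  then show ?thesis
    using assms by (simp add: steiner_def line_measure_shift inner_add_left)
qed

lemma line_measure_steiner:
  fixes E :: "'a::euclidean_space set"
  assumes "E \<in> sets borel" "norm v = 1"
  shows "line_measure (steiner v E) v x = line_measure E v x"
proof -
  have "line_measure (steiner v E) v x = emeasure lborel {t. ennreal (2 * \<bar>x \<bullet> v + t\<bar>) < line_measure E v x}"
    unfolding line_measure_def[of "steiner v E"] mem_steiner_line[OF assms] ..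
  then show ?thesis by (simp add: emeasure_centred_interval)
qed

lemma emeasure_steiner:
  fixes E :: "'a::euclidean_space set"
  assumes "E \<in> sets borel" "norm v = 1"
  shows "emeasure lborel (steiner v E) = emeasure lborel E"
  using assms by (simp add: emeasure_eq_integral_line_measure[of _ v] borel_steiner line_measure_steiner)

text \<open>Along a line the squared norm is a quadratic polynomial in the position, with minimum at
  the foot of the perpendicular from the origin. So each section of the ball is already an open
  segment centred where symmetrization would put it.\<close>

lemma steiner_ball:
  fixes v :: "'a::euclidean_space"
  assumes v: "norm v = 1"
  shows "steiner v (ball 0 r) = ball 0 r"
proof -
  have vv: "v \<bullet> v = 1"
    using v by (simp add: dot_square_norm)
  have "x \<in> steiner v (ball 0 r) \<longleftrightarrow> norm x < r" for x :: 'a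
  proof (cases "r > 0")
    case True
    define a where "a = x \<bullet> v"
    \<comment> \<open>\<open>w\<close> is \<open>r\<close> squared minus the squared distance of the
      line from the origin. If the line misses the ball, \<open>w\<close> may be negative;
      \<open>sqrt\<close> is strictly increasing on all reals, so no separate case arises.\<close>
    define w where "w = r\<^sup>2 - (norm x)\<^sup>2 + a\<^sup>2"
    have *: "norm (x + t *\<^sub>R v) < r \<longleftrightarrow> (a + t)\<^sup>2 < w" for t
    proof -
      have "norm (x + t *\<^sub>R v) < r \<longleftrightarrow> (norm (x + t *\<^sub>R v))\<^sup>2 < r\<^sup>2"
        using True by (auto intro: power_strict_mono power2_less_imp_less)
      also have "(norm (x + t *\<^sub>R v))\<^sup>2 = (norm x)\<^sup>2 + 2 * t * a + t\<^sup>2"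
        unfolding power2_norm_eq_inner a_def using vv
        by (simp add: inner_add_left inner_add_right inner_commute power2_eq_square)
      finally show ?thesis
        by (auto simp: w_def power2_eq_square algebra_simps)
    qed
    have "line_measure (ball 0 r) v x = emeasure lborel {t. (a + t)\<^sup>2 < w}"
      unfolding line_measure_def by (simp add: *)
    also have "{t. (a + t)\<^sup>2 < w} = {t. ennreal (2 * \<bar>a + t\<bar>) < ennreal (2 * sqrt w)}"
    proof -
      have "(a + t)\<^sup>2 < w \<longleftrightarrow> \<bar>a + t\<bar> < sqrt w" for t
        by (metis real_sqrt_abs real_sqrt_less_iff)
      then show ?thesis by (simp add: ennreal_less_iff)
    qed
    finally have lm: "line_measure (ball 0 r) v x = ennreal (2 * sqrt w)"
      by (simp add: emeasure_centred_interval)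
    have "x \<in> steiner v (ball 0 r) \<longleftrightarrow> \<bar>a\<bar> < sqrt w"
      unfolding steiner_def using lm by (simp add: a_def ennreal_less_iff)
    also have "\<dots> \<longleftrightarrow> a\<^sup>2 < w"
      by (metis real_sqrt_abs real_sqrt_less_iff)
    also have "\<dots> \<longleftrightarrow> norm x < r"
      using *[of 0] by simp
    finally show ?thesis .
  next
    case False
    then have "ball (0::'a) r = {}" by auto
    then have "line_measure (ball 0 r) v x = 0"
      unfolding line_measure_def by (simp only: empty_iff Collect_const if_False emeasure_empty)
    moreover have "\<not> norm x < r"
      using False norm_ge_zero[of x] by linarith
    ultimately show ?thesis
      by (simp add: steiner_def)
  qed
  then show ?thesis
    unfolding set_eq_iff mem_ball_0 by blast
qed

lemma steiner_mono:
  fixes E F :: "'a::euclidean_space set"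
  assumes "E \<subseteq> F" "F \<in> sets borel"
  shows "steiner v E \<subseteq> steiner v F"
  unfolding steiner_def using line_measure_mono[OF assms, of v] by (auto intro: order.strict_trans2)

text \<open>On each line the two symmetrals are concentric segments, so one contains the other. This
  is the largest overlap that the two lengths allow.\<close>

lemma line_measure_steiner_Int:
  fixes E F :: "'a::euclidean_space set"
  assumes "E \<in> sets borel" "F \<in> sets borel" "norm v = 1"
  shows "line_measure (steiner v E \<inter> steiner v F) v x = min (line_measure E v x) (line_measure F v x)"
proof -
  have "{t. x + t *\<^sub>R v \<in> steiner v E \<inter> steiner v F}
      = {t. ennreal (2 * \<bar>x \<bullet> v + t\<bar>) < min (line_measure E v x) (line_measure F v x)}"
    using assms by (auto simp: mem_steiner_line)
  then show ?thesis
    unfolding line_measure_def[of "steiner v E \<inter> steiner v F"]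
    by (simp only: emeasure_centred_interval)
qed

text \<open>A part of \<open>E - B\<close> that is carried into \<open>B - E\<close> by a single translation along \<open>v\<close> occupies
  on each line a share of both differences, and symmetrization makes up for it.\<close>
lemma steiner_gain:
  fixes E B :: "'a::euclidean_space set"
  assumes E [measurable]: "E \<in> sets borel" and B [measurable]: "B \<in> sets borel"
    and v: "norm v = 1" and BS: "steiner v B = B"
  shows "emeasure lborel (E \<inter> B) + emeasure lborel {x. x \<in> E - B \<and> x + s *\<^sub>R v \<in> B - E}
    \<le> emeasure lborel (steiner v E \<inter> B)"
proof -
  define G where "G = {x. x \<in> E - B \<and> x + s *\<^sub>R v \<in> B - E}"
  have G [measurable]: "G \<in> sets borel"
  proof -
    have "G = {x \<in> space borel. x \<in> E - B \<and> x + s *\<^sub>R v \<in> B - E}" by (simp add: G_def)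
    also have "\<dots> \<in> sets borel" by measurable
    finally show ?thesis .
  qed
  have S [measurable]: "steiner v E \<in> sets borel" by (rule borel_steiner[OF E])
  have add: "line_measure (E \<inter> B) v x + line_measure H v x \<le> line_measure F v x"
    if "E \<inter> B \<subseteq> F" "H \<subseteq> F - (E \<inter> B)" "H \<in> sets borel" "F \<in> sets borel" for F H :: "'a set" and x
  proof -
    have "line_measure (E \<inter> B) v x + line_measure H v x
        = emeasure lborel ({t. x + t *\<^sub>R v \<in> E \<inter> B} \<union> {t. x + t *\<^sub>R v \<in> H})"
      unfolding line_measure_def
      by (rule plus_emeasure) (use that borel_line_section[of "E \<inter> B"] borel_line_section[of H] in auto)
    also have "\<dots> \<le> line_measure F v x"
      unfolding line_measure_def by (rule emeasure_mono) (use that borel_line_section in auto)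
    finally show ?thesis .
  qed
  \<comment> \<open>\<open>H\<close> is \<open>G\<close> moved by \<open>s *\<^sub>R v\<close>,
    hence a part of \<open>B - E\<close>. The shift is along \<open>v\<close>, so it keeps the
    length on every line.\<close>
  define H where "H = {x. (- s) *\<^sub>R v + x \<in> G}"
  have H [measurable]: "H \<in> sets borel"
  proof -
    have "H = {x \<in> space borel. (- s) *\<^sub>R v + x \<in> G}" by (simp add: H_def)
    also have "\<dots> \<in> sets borel" by measurable
    finally show ?thesis .
  qed
  have GH: "line_measure H v x = line_measure G v x" for x
  proof -
    have "line_measure H v x = line_measure G v (x + (- s) *\<^sub>R v)"
      unfolding line_measure_def H_def by (simp add: algebra_simps)
    then show ?thesis by (simp add: line_measure_shift del: scaleR_minus_left)
  qed
  \<comment> \<open>On each line \<open>E\<close> contains the disjoint sets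
    \<open>E \<inter> B\<close> and \<open>G\<close>, and \<open>B\<close> contains the disjoint
    sets \<open>E \<inter> B\<close> and \<open>H\<close>. The same sum thus bounds both lengths
    from below, hence their minimum.\<close>
  have le: "line_measure (E \<inter> B) v x + line_measure G v x \<le> line_measure (steiner v E \<inter> B) v x" for x
  proof -
    have "line_measure (E \<inter> B) v x + line_measure G v x \<le> line_measure E v x"
      by (rule add) (auto simp: G_def)
    moreover have "line_measure (E \<inter> B) v x + line_measure H v x \<le> line_measure B v x"
      by (rule add) (auto simp: G_def H_def)
    ultimately show ?thesis
      using line_measure_steiner_Int[OF E B v, of x] by (simp add: GH BS)
  qed
  have "emeasure lborel (E \<inter> B) + emeasure lborel G
      = (\<integral>\<^sup>+x. indicator {0..1} (x \<bullet> v) * line_measure (E \<inter> B) v x \<partial>lborel)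
        + (\<integral>\<^sup>+x. indicator {0..1} (x \<bullet> v) * line_measure G v x \<partial>lborel)"
    by (simp add: emeasure_eq_integral_line_measure[OF _ v])
  also have "\<dots> = (\<integral>\<^sup>+x. indicator {0..1} (x \<bullet> v) * (line_measure (E \<inter> B) v x + line_measure G v x) \<partial>lborel)"
    by (subst nn_integral_add[symmetric]) (auto simp: distrib_left)
  also have "\<dots> \<le> (\<integral>\<^sup>+x. indicator {0..1} (x \<bullet> v) * line_measure (steiner v E \<inter> B) v x \<partial>lborel)"
    by (intro nn_integral_mono mult_left_mono le) simp
  also have "\<dots> = emeasure lborel (steiner v E \<inter> B)"
    by (simp add: emeasure_eq_integral_line_measure[OF _ v])
  finally show ?thesis by (simp add: G_def)
qed

section \<open>Determinant-like functions and convergence to balls\<close>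

text \<open>\<open>D\<close> is a linear form, without constant term, in the components along \<open>v\<close>: it vanishes when all
  points lie in the hyperplane orthogonal to \<open>v\<close>.\<close>
definition line_linear :: "('a::euclidean_space^'m \<Rightarrow> real) \<Rightarrow> bool" where
  "line_linear D \<longleftrightarrow> (\<forall>v z. norm v = 1 \<longrightarrow>
     (\<exists>a. \<forall>t. D (\<chi> j. z $ j + t j *\<^sub>R v) = (\<Sum>j\<in>UNIV. a j * (z $ j \<bullet> v + t j))))"

text \<open>If all differences of a set of reals are below \<open>l\<close>, the set lies in an
  interval of length \<open>l\<close> starting at its infimum. The strict inequality in
  \<open>steiner\<close> excludes this, and so yields actual points without any compactness of
  \<open>E\<close>.\<close>

lemma steiner_point_pair:
  assumes "x \<in> steiner v E"
  obtains p q where "x + p *\<^sub>R v \<in> E" "x + q *\<^sub>R v \<in> E" "p - q \<ge> 2 * \<bar>x \<bullet> v\<bar>"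
proof -
  define T where "T = {t. x + t *\<^sub>R v \<in> E}"
  define l where "l = 2 * \<bar>x \<bullet> v\<bar>"
  have big: "ennreal l < emeasure lborel T"
    using assms by (simp add: steiner_def line_measure_def T_def l_def)
  have "\<exists>p\<in>T. \<exists>q\<in>T. p - q \<ge> l"
  proof (rule ccontr)
    assume "\<not> ?thesis"
    then have close: "p - q < l" if "p \<in> T" "q \<in> T" for p q
      using that by force
    have "T \<noteq> {}" using big by auto
    then obtain t0 where t0: "t0 \<in> T" by blast
    have bdd: "bdd_below T"
      using close[OF t0] by (intro bdd_belowI[of _ "t0 - l"]) force
    have "T \<subseteq> {Inf T..Inf T + l}"
    proof
      fix p assume p: "p \<in> T"
      have "p - l \<le> Inf T"
        using \<open>T \<noteq> {}\<close> close[OF p] by (intro cInf_greatest) force+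
      then show "p \<in> {Inf T..Inf T + l}"
        using cInf_lower[OF p bdd] by auto
    qed
    then have "emeasure lborel T \<le> emeasure lborel {Inf T..Inf T + l}"
      by (intro emeasure_mono) auto
    with big show False by (simp add: l_def)
  qed
  then show thesis using that by (auto simp: T_def l_def)
qed

text \<open>Moving every point to the end of its chord favoured by the sign of its coefficient, and then
  to the opposite end, changes \<open>D\<close> by at least twice its value at \<open>z\<close>.\<close>
lemma line_linear_bound_steiner:
  fixes D :: "'a::euclidean_space^'m::finite \<Rightarrow> real"
  assumes D: "line_linear D" and v: "norm v = 1"
    and bound: "\<And>z. (\<And>j. z $ j \<in> E j) \<Longrightarrow> \<bar>D z\<bar> \<le> c"
    and z: "\<And>j. z $ j \<in> steiner v (E j)"
  shows "\<bar>D z\<bar> \<le> c"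
proof -
  obtain a where a: "\<And>t. D (\<chi> j. z $ j + t j *\<^sub>R v) = (\<Sum>j\<in>UNIV. a j * (z $ j \<bullet> v + t j))"
    using D v unfolding line_linear_def by metis
  have "\<exists>p q. z $ j + p *\<^sub>R v \<in> E j \<and> z $ j + q *\<^sub>R v \<in> E j \<and> p - q \<ge> 2 * \<bar>z $ j \<bullet> v\<bar>" for j
    using steiner_point_pair[OF z[of j]] by metis
  then obtain p q where pq: "\<And>j. z $ j + p j *\<^sub>R v \<in> E j" "\<And>j. z $ j + q j *\<^sub>R v \<in> E j"
      "\<And>j. p j - q j \<ge> 2 * \<bar>z $ j \<bullet> v\<bar>"
    by metis
  define p' q' where "p' j = (if a j \<ge> 0 then p j else q j)" and "q' j = (if a j \<ge> 0 then q j else p j)" for j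
  have "\<bar>D (\<chi> j. z $ j + p' j *\<^sub>R v)\<bar> \<le> c" "\<bar>D (\<chi> j. z $ j + q' j *\<^sub>R v)\<bar> \<le> c"
    using pq by (auto intro!: bound simp: p'_def q'_def)
  moreover have "D (\<chi> j. z $ j + p' j *\<^sub>R v) - D (\<chi> j. z $ j + q' j *\<^sub>R v) = (\<Sum>j\<in>UNIV. a j * (p' j - q' j))"
    unfolding a sum_subtractf[symmetric] by (intro sum.cong) (auto simp: algebra_simps)
  moreover have "(\<Sum>j\<in>UNIV. \<bar>a j * (z $ j \<bullet> v)\<bar> * 2) \<le> (\<Sum>j\<in>UNIV. a j * (p' j - q' j))"
  proof (rule sum_mono)
    fix j
    have "\<bar>a j\<bar> * (2 * \<bar>z $ j \<bullet> v\<bar>) \<le> \<bar>a j\<bar> * (p j - q j)"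
      using pq(3) by (intro mult_left_mono) auto
    then show "\<bar>a j * (z $ j \<bullet> v)\<bar> * 2 \<le> a j * (p' j - q' j)"
      by (cases "a j \<ge> 0") (simp_all add: p'_def q'_def abs_mult algebra_simps)
  qed
  moreover have "\<bar>D z\<bar> * 2 \<le> (\<Sum>j\<in>UNIV. \<bar>a j * (z $ j \<bullet> v)\<bar> * 2)"
  proof -
    have "D z = (\<Sum>j\<in>UNIV. a j * (z $ j \<bullet> v))"
      using a[of "\<lambda>_. 0"] by (simp add: vec_nth_inverse)
    then show ?thesis
      by (simp add: sum_distrib_right[symmetric] sum_abs)
  qed
  ultimately show ?thesis by linarith
qed

section \<open>Approaching the balls by repeated symmetrization\<close>

lemma emeasure_eq_measure_bounded:
  fixes S :: "'a::euclidean_space set"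
  assumes "bounded S"
  shows "emeasure lborel S = ennreal (measure lborel S)"
  using emeasure_bounded_finite[OF assms] by (simp add: emeasure_eq_ennreal_measure top.not_eq_extremum)

text \<open>By Fubini the overlaps, integrated over all \<open>w\<close>, give the product of the
  two measures, at least \<open>e\<^sup>2\<close>. Only \<open>w\<close> in the ball of radius
  \<open>2 * R\<close> contribute, so the average over that ball is at least
  \<open>e\<^sup>2\<close> over its volume; the extra factor 2 makes room for a strict
  inequality.\<close>

lemma exists_overlapping_translate:
  fixes P Q :: "'a::euclidean_space set"
  assumes P [measurable]: "P \<in> sets borel" and Q [measurable]: "Q \<in> sets borel"
    and PR: "P \<subseteq> ball 0 R" and QR: "Q \<subseteq> ball 0 R" and e: "e > 0"
    and Pe: "measure lborel P \<ge> e" and Qe: "measure lborel Q \<ge> e"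
  shows "\<exists>w. emeasure lborel {x. x \<in> P \<and> x + w \<in> Q} > ennreal (e\<^sup>2 / (2 * measure lborel (ball (0::'a) (2 * R))))"
proof (rule ccontr)
  define V where "V = measure lborel (ball (0::'a) (2 * R))"
  assume "\<not> ?thesis"
  then have le: "emeasure lborel {x. x \<in> P \<and> x + w \<in> Q} \<le> ennreal (e\<^sup>2 / (2 * V))" for w
    by (simp add: not_less V_def)
  have fin: "emeasure lborel P = ennreal (measure lborel P)" "emeasure lborel Q = ennreal (measure lborel Q)"
    using PR QR bounded_subset[OF bounded_ball] by (blast intro: emeasure_eq_measure_bounded)+
  have "P \<noteq> {}" using Pe e by auto
  then have "ball (0::'a) R \<noteq> {}" using PR by blast
  then have R: "R > 0" by simp
  then have V: "V > 0"
    by (simp add: V_def content_ball)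
  have "ennreal (measure lborel P) * ennreal (measure lborel Q)
      = (\<integral>\<^sup>+x. indicator P x * (\<integral>\<^sup>+w. indicator Q (x + w) \<partial>lborel) \<partial>lborel)"
    by (simp add: nn_integral_lborel_translate[of "indicator Q"] nn_integral_multc fin)
  also have "\<dots> = (\<integral>\<^sup>+x. (\<integral>\<^sup>+w. indicator P x * indicator Q (x + w) \<partial>lborel) \<partial>lborel)"
    by (simp add: nn_integral_cmult)
  also have "\<dots> = (\<integral>\<^sup>+w. (\<integral>\<^sup>+x. indicator P x * indicator Q (x + w) \<partial>lborel) \<partial>lborel)"
    by (rule lborel_pair.Fubini'[symmetric]) measurable
  also have "\<dots> \<le> (\<integral>\<^sup>+w. ennreal (e\<^sup>2 / (2 * V)) * indicator (ball (0::'a) (2 * R)) w \<partial>lborel)"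
  proof (rule nn_integral_mono)
    fix w :: 'a
    have meas: "{x. x \<in> P \<and> x + w \<in> Q} \<in> sets borel"
    proof -
      have "{x. x \<in> P \<and> x + w \<in> Q} = {x \<in> space borel. x \<in> P \<and> x + w \<in> Q}" by simp
      also have "\<dots> \<in> sets borel" by measurable
      finally show ?thesis .
    qed
    have "(\<integral>\<^sup>+x. indicator P x * indicator Q (x + w) \<partial>lborel)
        = (\<integral>\<^sup>+x. indicator {x. x \<in> P \<and> x + w \<in> Q} x \<partial>lborel)"
      by (intro nn_integral_cong) (auto simp: indicator_def)
    also have "\<dots> = emeasure lborel {x. x \<in> P \<and> x + w \<in> Q}"
      using meas by simp
    also have "\<dots> \<le> ennreal (e\<^sup>2 / (2 * V)) * indicator (ball 0 (2 * R)) w"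
    proof (cases "norm w < 2 * R")
      case True
      then show ?thesis using le[of w] by simp
    next
      case False
      have "{x. x \<in> P \<and> x + w \<in> Q} = {}"
      proof (rule ccontr)
        assume "\<not> ?thesis"
        then obtain x where "x \<in> P" "x + w \<in> Q" by blast
        then have "norm x < R" "norm (x + w) < R" using PR QR by auto
        then show False using False norm_triangle_ineq4[of "x + w" x] by simp
      qed
      then have "emeasure lborel {x. x \<in> P \<and> x + w \<in> Q} = 0"
        by (simp only: emeasure_empty)
      then show ?thesis by simp
    qed
    finally show "(\<integral>\<^sup>+x. indicator P x * indicator Q (x + w) \<partial>lborel)
      \<le> ennreal (e\<^sup>2 / (2 * V)) * indicator (ball 0 (2 * R)) w" .
  qed
  also have "\<dots> = ennreal (e\<^sup>2 / (2 * V)) * emeasure lborel (ball (0::'a) (2 * R))"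
    by (rule nn_integral_cmult_indicator) simp
  also have "\<dots> = ennreal (e\<^sup>2 / (2 * V)) * ennreal V"
    unfolding V_def by (simp add: emeasure_eq_measure_bounded)
  finally have "measure lborel P * measure lborel Q \<le> e\<^sup>2 / (2 * V) * V"
    using V by (simp add: ennreal_mult[symmetric])
  moreover have "e * e \<le> measure lborel P * measure lborel Q"
    using Pe Qe e by (intro mult_mono) auto
  ultimately have "e * e \<le> e * e / 2"
    using V by (simp add: power2_eq_square)
  with e show False by simp
qed

text \<open>The class of families over which the overlap with the balls of radii \<open>r j\<close>
  is maximized. The common radius \<open>R\<close> bounds the translations to be averaged, which
  makes the gain of a symmetrization uniform over the class.\<close>

definition admissible :: "('a::euclidean_space^'m \<Rightarrow> real) \<Rightarrow> real \<Rightarrow> real \<Rightarrow> ('m \<Rightarrow> real) \<Rightarrow> ('m \<Rightarrow> 'a set) \<Rightarrow> bool" where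
  "admissible D c R r F \<longleftrightarrow>
     (\<forall>j. F j \<in> sets borel \<and> F j \<subseteq> ball 0 R \<and> measure lborel (ball (0::'a) (r j)) \<le> measure lborel (F j)) \<and>
     (\<forall>z. (\<forall>j. z $ j \<in> F j) \<longrightarrow> \<bar>D z\<bar> \<le> c)"

lemma admissible_steiner:
  fixes D :: "'a::euclidean_space^'m::finite \<Rightarrow> real"
  assumes D: "line_linear D" and F: "admissible D c R r F" and v: "norm v = 1"
  shows "admissible D c R r (\<lambda>j. steiner v (F j))"
  unfolding admissible_def
proof (intro conjI allI impI)
  fix j
  have Fj: "F j \<in> sets borel" "F j \<subseteq> ball 0 R" "measure lborel (ball (0::'a) (r j)) \<le> measure lborel (F j)"
    using F by (auto simp: admissible_def)
  show "steiner v (F j) \<in> sets borel"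
    using Fj by (intro borel_steiner)
  show "steiner v (F j) \<subseteq> ball 0 R"
    using steiner_mono[OF Fj(2), of v] by (simp add: steiner_ball v)
  show "measure lborel (ball (0::'a) (r j)) \<le> measure lborel (steiner v (F j))"
    using Fj emeasure_steiner[OF Fj(1) v] by (simp add: measure_def)
next
  fix z :: "'a^'m" assume "\<forall>j. z $ j \<in> steiner v (F j)"
  then show "\<bar>D z\<bar> \<le> c"
    by - (rule line_linear_bound_steiner[OF D v, of F], use F in \<open>auto simp: admissible_def\<close>)
qed

text \<open>\<open>steiner_gain\<close> in real numbers: all three sets are bounded because each
  lies in a ball or in a translate of one, even if \<open>E\<close> is unbounded.\<close>

lemma measure_Int_steiner_mono:
  fixes E :: "'a::euclidean_space set"
  assumes "E \<in> sets borel" and v: "norm v = 1"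
  shows "measure lborel (E \<inter> ball 0 r) + measure lborel {x. x \<in> E - ball 0 r \<and> x + s *\<^sub>R v \<in> ball 0 r - E}
    \<le> measure lborel (steiner v E \<inter> ball 0 r)"
proof -
  have "{x. x \<in> E - ball 0 r \<and> x + s *\<^sub>R v \<in> ball 0 r - E} \<subseteq> cball (- (s *\<^sub>R v)) r"
  proof
    fix x assume "x \<in> {x. x \<in> E - ball 0 r \<and> x + s *\<^sub>R v \<in> ball 0 r - E}"
    moreover have "dist (- (s *\<^sub>R v)) x = norm (x + s *\<^sub>R v)"
      by (metis add.commute diff_minus_eq_add dist_commute dist_norm)
    ultimately show "x \<in> cball (- (s *\<^sub>R v)) r" by simp
  qed
  then have "bounded {x. x \<in> E - ball 0 r \<and> x + s *\<^sub>R v \<in> ball 0 r - E}"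
    using bounded_cball bounded_subset by blast
  moreover have "bounded (E \<inter> ball 0 r)" "bounded (steiner v E \<inter> ball 0 r)"
    using bounded_Int bounded_ball by blast+
  ultimately show ?thesis
    using steiner_gain[OF assms(1) _ v steiner_ball[OF v], of r s]
    by (simp add: emeasure_eq_measure_bounded ennreal_plus[symmetric] del: ennreal_plus)
qed

text \<open>Let \<open>\<Phi>\<close> be the total overlap with the balls. If no family were close
  to the balls, every admissible family could be symmetrized so that \<open>\<Phi>\<close> grows by
  a fixed \<open>\<eta>\<close>, which is impossible near the supremum. No sequence of sets has to
  converge.\<close>

lemma admissible_near_balls:
  fixes D :: "'a::euclidean_space^'m::finite \<Rightarrow> real"
  assumes D: "line_linear D" and F0: "admissible D c R r F0" and r: "\<And>j. r j \<le> R" and e: "e > 0"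
  shows "\<exists>F. admissible D c R r F \<and> (\<forall>j. measure lborel (ball 0 (r j) - F j) < e)"
proof (rule ccontr)
  assume neg: "\<not> ?thesis"
  define B where "B j = ball (0::'a) (r j)" for j
  define \<Phi> where "\<Phi> F = (\<Sum>j\<in>UNIV. measure lborel (F j \<inter> B j))" for F :: "'m \<Rightarrow> 'a set"
  define V where "V = measure lborel (ball (0::'a) (2 * R))"
  define \<eta> where "\<eta> = e\<^sup>2 / (2 * V)"
  define S where "S = \<Phi> ` Collect (admissible D c R r)"
  have fm: "A \<in> fmeasurable lborel" if "A \<in> sets borel" "bounded A" for A :: "'a set"
    using that emeasure_bounded_finite by (auto intro!: fmeasurableI)
  have bB: "bounded (B j)" "B j \<in> sets borel" for j by (auto simp: B_def)
  have "S \<noteq> {}" using F0 by (auto simp: S_def)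
  have bdd: "bdd_above S"
    unfolding S_def
  proof (rule bdd_aboveI2)
    fix F assume "F \<in> Collect (admissible D c R r)"
    then show "\<Phi> F \<le> (\<Sum>j\<in>UNIV. measure lborel (B j))"
      unfolding \<Phi>_def using bB by (intro sum_mono measure_mono_fmeasurable) (auto simp: admissible_def intro!: fm)
  qed
  have step: "\<exists>F'. admissible D c R r F' \<and> \<eta> > 0 \<and> \<Phi> F' \<ge> \<Phi> F + \<eta>" if F: "admissible D c R r F" for F
  proof -
    obtain j where j: "measure lborel (B j - F j) \<ge> e"
      using neg F by (auto simp: B_def not_less)
    have Fb: "F i \<in> sets borel" "F i \<subseteq> ball 0 R" "bounded (F i)" for i
      using F bounded_subset[OF bounded_ball, of "F i" 0 R] by (simp_all add: admissible_def)
    have split: "measure lborel (X - Y) + measure lborel (X \<inter> Y) = measure lborel X"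
      if "X \<in> sets borel" "Y \<in> sets borel" "bounded X" for X Y :: "'a set"
    proof -
      have "X - Y \<in> fmeasurable lborel" "X \<inter> Y \<in> fmeasurable lborel"
        using that bounded_subset[of X] by (auto intro!: fm)
      then have "measure lborel ((X - Y) \<union> (X \<inter> Y)) = measure lborel (X - Y) + measure lborel (X \<inter> Y)"
        by (intro measure_Un_AE) auto
      then show ?thesis by (simp add: Un_Diff_Int)
    qed
    \<comment> \<open>Since \<open>F j\<close> has at least the volume of \<open>B j\<close>, its
      part outside \<open>B j\<close> is at least as large as the part of \<open>B j\<close> that it
      misses. So both differences have measure at least \<open>e\<close>.\<close>
    have "measure lborel (F j - B j) + measure lborel (F j \<inter> B j) = measure lborel (F j)"
      by (rule split) (use Fb bB in auto)
    moreover have "measure lborel (B j - F j) + measure lborel (F j \<inter> B j) = measure lborel (B j)"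
      unfolding Int_commute[of "F j"] by (rule split) (use Fb bB in auto)
    moreover have "measure lborel (B j) \<le> measure lborel (F j)"
      using F by (auto simp: admissible_def B_def)
    ultimately have j': "measure lborel (F j - B j) \<ge> e"
      using j by linarith
    have "\<exists>w. emeasure lborel {x. x \<in> F j - B j \<and> x + w \<in> B j - F j} > ennreal \<eta>"
      unfolding \<eta>_def V_def
    proof (rule exists_overlapping_translate[OF _ _ _ _ e j' j])
      show "F j - B j \<subseteq> ball 0 R" "B j - F j \<subseteq> ball 0 R"
        using Fb[of j] r[of j] by (auto simp: B_def)
    qed (use Fb bB in auto)
    then obtain w where w: "emeasure lborel {x. x \<in> F j - B j \<and> x + w \<in> B j - F j} > ennreal \<eta>" ..
    have "w \<noteq> 0"
    proof
      assume "w = 0"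
      then have "{x. x \<in> F j - B j \<and> x + w \<in> B j - F j} = {}" by auto
      with w show False by (simp only: emeasure_empty) simp
    qed
    define v where "v = w /\<^sub>R norm w"
    have v: "norm v = 1" and wv: "w = norm w *\<^sub>R v"
      using \<open>w \<noteq> 0\<close> by (auto simp: v_def)
    \<comment> \<open>Keeping the bound on \<open>D\<close> requires symmetrizing all sets in the
      same direction \<open>v\<close>, although it is chosen for \<open>j\<close> alone. The other
      overlaps do not decrease, as \<open>G i\<close> has nonnegative measure.\<close>
    define G where "G i = {x. x \<in> F i - B i \<and> x + norm w *\<^sub>R v \<in> B i - F i}" for i
    have gain: "measure lborel (F i \<inter> B i) + measure lborel (G i) \<le> measure lborel (steiner v (F i) \<inter> B i)" for i
      unfolding B_def G_def by (rule measure_Int_steiner_mono[OF Fb(1) v])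
    have "bounded (G j)"
      by (rule bounded_subset[OF Fb(3)[of j]]) (auto simp: G_def)
    then have "ennreal \<eta> < ennreal (measure lborel (G j))"
      using w unfolding G_def wv[symmetric] by (simp only: emeasure_eq_measure_bounded)
    moreover have "\<eta> \<ge> 0" by (simp add: \<eta>_def V_def)
    ultimately have Gj: "measure lborel (G j) > \<eta>"
      by (simp add: ennreal_less_iff)
    have "\<Phi> F + measure lborel (G j) \<le> \<Phi> F + (\<Sum>i\<in>UNIV. measure lborel (G i))"
      by (intro add_left_mono member_le_sum) auto
    also have "\<dots> = (\<Sum>i\<in>UNIV. measure lborel (F i \<inter> B i) + measure lborel (G i))"
      by (simp add: \<Phi>_def sum.distrib)
    also have "\<dots> \<le> \<Phi> (\<lambda>i. steiner v (F i))"
      unfolding \<Phi>_def by (intro sum_mono gain)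
    finally have *: "\<Phi> F + \<eta> \<le> \<Phi> (\<lambda>i. steiner v (F i))" using Gj by simp
    have "F j - B j \<noteq> {}"
    proof
      assume "F j - B j = {}"
      with j' e show False by (simp only: measure_empty)
    qed
    then have "ball (0::'a) R \<noteq> {}" using Fb(2)[of j] by blast
    then have "R > 0" by simp
    then have "\<eta> > 0" using e by (simp add: \<eta>_def V_def content_ball)
    with * show ?thesis
      using admissible_steiner[OF D F v] by blast
  qed
  have "\<eta> > 0" using step[OF F0] by blast
  then obtain y where "y \<in> S" "Sup S - \<eta> < y"
    using less_cSupE[of "Sup S - \<eta>" S] \<open>S \<noteq> {}\<close> by auto
  then obtain F where F: "admissible D c R r F" "Sup S - \<eta> < \<Phi> F"
    by (auto simp: S_def)
  obtain F' where "admissible D c R r F'" "\<Phi> F + \<eta> \<le> \<Phi> F'"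
    using step[OF F(1)] by blast
  then have "\<Phi> F + \<eta> \<le> Sup S"
    using cSup_upper[OF _ bdd, of "\<Phi> F'"] by (auto simp: S_def)
  with F show False by simp
qed

lemma continuous_gt_near:
  fixes D :: "'a::euclidean_space^'m::finite \<Rightarrow> real"
  assumes "continuous_on UNIV D" "c < \<bar>D z\<bar>"
  obtains d where "d > 0" "\<And>y. (\<And>j. y $ j \<in> ball (z $ j) d) \<Longrightarrow> c < \<bar>D y\<bar>"
proof -
  have "open {y. c < \<bar>D y\<bar>}"
    using assms by (intro open_Collect_less continuous_intros)
  then obtain d where d: "d > 0" "ball z d \<subseteq> {y. c < \<bar>D y\<bar>}"
    using assms by (metis mem_Collect_eq openE)
  \<comment> \<open>The distance of two tuples is at most the sum of the distances of their
    components, so \<open>d\<close> is shared equally among them.\<close>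
  define d' where "d' = d / real CARD('m)"
  show thesis
  proof
    show "d' > 0" using d by (simp add: d'_def)
    fix y assume y: "\<And>j. y $ j \<in> ball (z $ j) d'"
    have "dist z y \<le> (\<Sum>j\<in>UNIV. dist (z $ j) (y $ j))"
      unfolding dist_vec_def by (rule L2_set_le_sum) simp
    also have "\<dots> < (\<Sum>j\<in>(UNIV::'m set). d')"
      using y by (intro sum_strict_mono) auto
    also have "\<dots> = d" by (simp add: d'_def)
    finally show "c < \<bar>D y\<bar>" using d by auto
  qed
qed

text \<open>If the bound failed at \<open>z\<close>, it would fail on a product of small balls about
  the \<open>z $ j\<close>. An admissible family that nearly fills the balls meets each small ball,
  and the points found there contradict its own bound.\<close>

lemma admissible_bound_balls:
  fixes D :: "'a::euclidean_space^'m::finite \<Rightarrow> real"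
  assumes D: "line_linear D" and cont: "continuous_on UNIV D"
    and F0: "admissible D c R r F0" and r: "\<And>j. r j \<le> R" and z: "\<And>j. z $ j \<in> ball 0 (r j)"
  shows "\<bar>D z\<bar> \<le> c"
proof (rule ccontr)
  assume "\<not> ?thesis"
  then obtain d where d: "d > 0" "\<And>y. (\<And>j. y $ j \<in> ball (z $ j) d) \<Longrightarrow> c < \<bar>D y\<bar>"
    using continuous_gt_near[OF cont, of c z] by (auto simp: not_le)
  have "\<forall>j. \<exists>e>0. ball (z $ j) e \<subseteq> ball 0 (r j)"
    using z by (meson open_ball openE)
  then obtain e where e: "\<And>j. e j > 0" "\<And>j. ball (z $ j) (e j) \<subseteq> ball 0 (r j)"
    by metis
  define s where "s = min d (Min (range e))"
  have s: "s > 0" "s \<le> d" "s \<le> e j" for j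
    using d e by (auto simp: s_def Min_gr_iff intro: min.coboundedI2)
  \<comment> \<open>A set missing less than this volume of \<open>ball 0 (r j)\<close> cannot miss a
    whole ball of radius \<open>s\<close> inside it.\<close>
  define V where "V = measure lborel (ball (0::'a) s)"
  have V: "V > 0" using s by (simp add: V_def content_ball)
  obtain F where F: "admissible D c R r F" "\<And>j. measure lborel (ball 0 (r j) - F j) < V"
    using admissible_near_balls[OF D F0 r V] by auto
  have "\<exists>x. x \<in> F j \<inter> ball (z $ j) s" for j
  proof (rule ccontr)
    assume "\<not> ?thesis"
    then have "ball (z $ j) s \<subseteq> ball 0 (r j) - F j"
      using e(2)[of j] s(3)[of j] by (auto simp: subset_eq)
    moreover have "ball 0 (r j) - F j \<in> fmeasurable lborel"
      using F(1) emeasure_bounded_finite[OF bounded_diff[OF bounded_ball[of 0 "r j"], of "F j"]]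
      by (intro fmeasurableI) (auto simp: admissible_def)
    ultimately have "measure lborel (ball (z $ j) s) \<le> measure lborel (ball 0 (r j) - F j)"
      by (intro measure_mono_fmeasurable) auto
    moreover have "measure lborel (ball (z $ j) s) = V"
      using s by (simp add: V_def content_ball)
    ultimately show False using F(2)[of j] by simp
  qed
  then obtain x where x: "\<And>j. x j \<in> F j \<inter> ball (z $ j) s" by metis
  have "x j \<in> ball (z $ j) d" for j
    using x[of j] s(2) by auto
  then have "c < \<bar>D (\<chi> j. x j)\<bar>"
    by (intro d(2)) simp
  moreover have "\<bar>D (\<chi> j. x j)\<bar> \<le> c"
    using F(1) x by (auto simp: admissible_def)
  ultimately show False by simp
qed

section \<open>From almost everywhere bounds to bounds on balls\<close>

lemma prod_Basis_vec:
  fixes f :: "'a::euclidean_space^'m::finite \<Rightarrow> 'b::comm_monoid_mult"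
  shows "(\<Prod>b\<in>Basis. f b) = (\<Prod>i\<in>UNIV. \<Prod>u\<in>Basis. f (axis i u))"
proof -
  have B: "(Basis :: ('a^'m) set) = (\<Union>i\<in>UNIV. axis i ` Basis)"
    by (auto simp: Basis_vec_def)
  have "(\<Prod>b\<in>Basis. f b) = (\<Prod>i\<in>UNIV. \<Prod>b\<in>axis i ` Basis. f b)"
    by (subst B) (intro prod.UNION_disjoint, auto simp: axis_eq_axis)
  also have "\<dots> = (\<Prod>i\<in>UNIV. \<Prod>u\<in>Basis. f (axis i u))"
    by (intro prod.cong refl) (subst prod.reindex, auto simp: inj_on_def axis_eq_axis)
  finally show ?thesis .
qed

lemma mem_box_vec:
  fixes l u z :: "'a::euclidean_space^'m::finite"
  shows "z \<in> box l u \<longleftrightarrow> (\<forall>j. z $ j \<in> box (l $ j) (u $ j))"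
  by (auto simp: mem_box Basis_vec_def inner_axis)

lemma measurable_vec_lambda_PiM:
  "(\<lambda>f. \<chi> i. f i) \<in> PiM (UNIV :: 'm::finite set) (\<lambda>_. lborel :: 'a::euclidean_space measure) \<rightarrow>\<^sub>M borel"
  by (subst borel_measurable_euclidean_space) (auto simp: Basis_vec_def inner_axis)

text \<open>Both measures give a box the product of its side lengths, which characterizes Lebesgue
  measure. This makes measures of product sets computable.\<close>

lemma lborel_vec_eq_distr_PiM:
  "(lborel :: ('a::euclidean_space^'m::finite) measure)
    = distr (PiM UNIV (\<lambda>_. lborel)) borel (\<lambda>f. \<chi> i. f i)"
proof (rule lborel_eqI)
  interpret product_sigma_finite "\<lambda>_::'m. lborel :: 'a measure" ..
  fix l u :: "'a^'m"
  assume le: "\<And>b. b \<in> Basis \<Longrightarrow> l \<bullet> b \<le> u \<bullet> b"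
  then have le': "l $ i \<bullet> b \<le> u $ i \<bullet> b" if "b \<in> Basis" for i b
    using le[of "axis i b"] that by (simp add: inner_axis)
  have "emeasure (distr (PiM UNIV (\<lambda>_. lborel)) borel (\<lambda>f. \<chi> i. f i)) (box l u)
      = emeasure (PiM UNIV (\<lambda>_. lborel)) (PiE UNIV (\<lambda>i. box (l $ i) (u $ i)))"
    by (subst emeasure_distr[OF measurable_vec_lambda_PiM])
       (auto simp: mem_box_vec space_PiM PiE_iff intro!: arg_cong[where f = "emeasure _"])
  also have "\<dots> = (\<Prod>i\<in>UNIV. emeasure lborel (box (l $ i) (u $ i)))"
    by (rule emeasure_PiM) auto
  also have "\<dots> = (\<Prod>i\<in>UNIV. \<Prod>b\<in>Basis. ennreal ((u $ i - l $ i) \<bullet> b))"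
    using le' by (simp add: inner_diff_left prod_ennreal)
  also have "\<dots> = (\<Prod>b\<in>Basis. ennreal ((u - l) \<bullet> b))"
    by (simp add: prod_Basis_vec inner_axis)
  also have "\<dots> = ennreal (\<Prod>b\<in>Basis. (u - l) \<bullet> b)"
    using le by (simp add: prod_ennreal inner_diff_left)
  finally show "emeasure (distr (PiM UNIV (\<lambda>_. lborel)) borel (\<lambda>f. \<chi> i. f i)) (box l u)
    = ennreal (\<Prod>b\<in>Basis. (u - l) \<bullet> b)" .
qed simp

lemma emeasure_lborel_vec_Times:
  fixes A :: "'m::finite \<Rightarrow> 'a::euclidean_space set"
  assumes A: "\<And>j. A j \<in> sets borel"
  shows "emeasure lborel {z :: 'a^'m. \<forall>j. z $ j \<in> A j} = (\<Prod>j\<in>UNIV. emeasure lborel (A j))"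
proof -
  interpret product_sigma_finite "\<lambda>_::'m. lborel :: 'a measure" ..
  have "(\<lambda>z :: 'a^'m. z $ j) -` A j \<inter> space borel \<in> sets borel" for j
    by (rule measurable_sets[OF _ A]) (auto intro!: borel_measurable_continuous_onI continuous_intros)
  then have "(\<Inter>j. (\<lambda>z :: 'a^'m. z $ j) -` A j) \<in> sets borel"
    by (intro sets.countable_INT') auto
  also have "(\<Inter>j. (\<lambda>z :: 'a^'m. z $ j) -` A j) = {z. \<forall>j. z $ j \<in> A j}" by auto
  finally have "emeasure lborel {z :: 'a^'m. \<forall>j. z $ j \<in> A j}
      = emeasure (PiM UNIV (\<lambda>_. lborel)) (PiE UNIV A)"
    by (subst lborel_vec_eq_distr_PiM, subst emeasure_distr[OF measurable_vec_lambda_PiM])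
       (auto simp: space_PiM PiE_iff intro!: arg_cong[where f = "emeasure _"])
  also have "\<dots> = (\<Prod>j\<in>UNIV. emeasure lborel (A j))"
    by (rule emeasure_PiM) (use A in auto)
  finally show ?thesis .
qed

text \<open>Truncating by a large ball makes the measure finite while keeping it above
  \<open>m\<close>; inner regularity by closed sets does the rest.\<close>

lemma compact_inner_approx:
  fixes E :: "'a::euclidean_space set"
  assumes E: "E \<in> sets lebesgue" and m: "m < emeasure lebesgue E"
  obtains K where "compact K" "K \<subseteq> E" "m < emeasure lborel K"
proof -
  have "(SUP n. emeasure lebesgue (E \<inter> cball 0 (real n))) = emeasure lebesgue (\<Union>n. E \<inter> cball 0 (real n))"
    by (rule SUP_emeasure_incseq) (use E in \<open>auto simp: incseq_def\<close>)
  also have "(\<Union>n. E \<inter> cball 0 (real n)) = E"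
    by (auto simp: real_arch_simple)
  finally have "m < (SUP n. emeasure lebesgue (E \<inter> cball 0 (real n)))"
    using m by simp
  then obtain n where n: "m < emeasure lebesgue (E \<inter> cball 0 (real n))"
    unfolding less_SUP_iff by blast
  define F where "F = E \<inter> cball 0 (real n)"
  have F: "F \<in> lmeasurable" "F \<in> sets lebesgue"
    using E by (auto simp: F_def intro!: bounded_set_imp_lmeasurable sets.Int)
  have mF: "m < ennreal (measure lebesgue F)"
    using n F by (simp add: F_def[symmetric] emeasure_eq_measure2)
  then obtain m' where m': "m = ennreal m'" "m' \<ge> 0"
    by (cases m) auto
  have pos: "measure lebesgue F - m' > 0"
    using mF m' by (simp add: ennreal_less_iff)
  obtain T where T: "closed T" "T \<subseteq> F" "F - T \<in> lmeasurable"
      "emeasure lebesgue (F - T) < ennreal (measure lebesgue F - m')"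
    using sets_lebesgue_inner_closed[OF F(2) pos] .
  have "bounded T" using T(2) bounded_subset[OF bounded_cball, of T 0 "real n"] by (auto simp: F_def)
  then have "compact T" using T(1) by (simp add: compact_eq_bounded_closed)
  then have Tl: "T \<in> lmeasurable" by (rule lmeasurable_compact)
  have "measure lebesgue (F - T) < measure lebesgue F - m'"
    using T(3,4) pos by (simp add: emeasure_eq_measure2 ennreal_less_iff)
  moreover have "measure lebesgue (F - T) = measure lebesgue F - measure lebesgue T"
    using F Tl T(2) by (simp add: measurable_measure_Diff fmeasurableD)
  ultimately have "m' < measure lebesgue T" by simp
  then have "m < emeasure lebesgue T"
    using Tl m' by (simp add: emeasure_eq_measure2 ennreal_less_iff)
  moreover have "emeasure lebesgue T = emeasure lborel T"
    using \<open>closed T\<close> by simp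
  ultimately show thesis
    using that[of T] \<open>compact T\<close> T(2) by (auto simp: F_def)
qed

text \<open>Removing from a compact set all balls in which it is null removes only a locally
  negligible, hence negligible, part. On a product of such sets an almost everywhere bound on a
  continuous function holds at every point.\<close>

lemma compact_inner_approx_full_support:
  fixes E :: "'a::euclidean_space set"
  assumes E: "E \<in> sets lebesgue" and m: "m < emeasure lebesgue E"
  obtains K where "compact K" "K \<subseteq> E" "m < emeasure lborel K"
    "\<And>x d. x \<in> K \<Longrightarrow> d > 0 \<Longrightarrow> emeasure lborel (K \<inter> ball x d) \<noteq> 0"
proof -
  obtain T where T: "compact T" "T \<subseteq> E" "m < emeasure lborel T"
    using compact_inner_approx[OF E m] .
  define U where "U = \<Union>{ball x d | x d. emeasure lborel (T \<inter> ball x d) = 0}"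
  have "open U" by (auto simp: U_def)
  have bT: "T \<in> sets borel" using T(1) by (simp add: compact_imp_closed)
  have "negligible (T \<inter> U)"
  proof (rule locally_negligible_alt[THEN iffD2], rule ballI)
    fix x assume "x \<in> T \<inter> U"
    then obtain y d where yd: "x \<in> ball y d" "emeasure lborel (T \<inter> ball y d) = 0"
      by (auto simp: U_def)
    have "negligible (T \<inter> ball y d)"
      using yd(2) bT by (simp add: negligible_iff_emeasure0)
    then have "negligible ((T \<inter> U) \<inter> ball y d)"
      by (rule negligible_subset) auto
    moreover have "openin (top_of_set (T \<inter> U)) ((T \<inter> U) \<inter> ball y d)"
      by (simp add: openin_open_Int)
    ultimately show "\<exists>V. openin (top_of_set (T \<inter> U)) V \<and> x \<in> V \<and> negligible V"
      using yd(1) \<open>x \<in> T \<inter> U\<close> by blast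
  qed
  then have null: "T \<inter> U \<in> null_sets lborel"
    using bT \<open>open U\<close> by (simp add: negligible_iff_null_sets null_sets_completion_iff)
  \<comment> \<open>Measures do not notice the removal of \<open>U\<close>. So a ball that is null
    for \<open>T - U\<close> was null for \<open>T\<close> and is already contained in
    \<open>U\<close>.\<close>
  have *: "emeasure lborel ((T - U) \<inter> W) = emeasure lborel (T \<inter> W)" if "W \<in> sets borel" for W
  proof -
    have "(T - U) \<inter> W = (T \<inter> W) - (T \<inter> U)" by auto
    then show ?thesis
      using null bT that by (simp add: emeasure_Diff_null_set)
  qed
  show thesis
  proof (rule that)
    show "compact (T - U)" using T(1) \<open>open U\<close> by (rule compact_diff)
    show "T - U \<subseteq> E" using T by auto
    show "m < emeasure lborel (T - U)" using *[of UNIV] T by simp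
    show "emeasure lborel ((T - U) \<inter> ball x d) \<noteq> 0" if "x \<in> T - U" "d > 0" for x d
    proof
      assume "emeasure lborel ((T - U) \<inter> ball x d) = 0"
      then have "emeasure lborel (T \<inter> ball x d) = 0" by (simp add: *)
      then have "x \<in> U" using that by (auto simp: U_def intro!: exI[of _ "ball x d"])
      with that show False by simp
    qed
  qed
qed

text \<open>Compact subsets of full support turn the almost everywhere bound into a bound everywhere
  on their product. They then form an admissible family, to which the result on balls
  applies.\<close>

lemma line_linear_AE_bound_balls:
  fixes D :: "'a::euclidean_space^'m::finite \<Rightarrow> real"
  assumes D: "line_linear D" and cont: "continuous_on UNIV D"
    and E: "\<And>j. E j \<in> sets lebesgue"
    and r: "\<And>j. emeasure lborel (ball (0::'a) (r j)) \<le> emeasure lebesgue (E j)"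
    and AE: "AE z in lebesgue. (\<forall>j. z $ j \<in> E j) \<longrightarrow> \<bar>D z\<bar> \<le> c"
    and z: "\<And>j. z $ j \<in> ball 0 (r j)"
  shows "\<bar>D z\<bar> \<le> c"
proof -
  \<comment> \<open>The midpoint radius keeps \<open>z $ j\<close> inside the smaller ball and makes
    its volume strictly less than the measure of \<open>E j\<close>, which leaves room for a compact
    subset.\<close>
  define s where "s j = (norm (z $ j) + r j) / 2" for j
  have s: "norm (z $ j) < s j" "s j < r j" "0 < s j" for j
    using z[of j] norm_ge_zero[of "z $ j"] by (auto simp: s_def simp del: norm_ge_zero)
  have sr: "ennreal (measure lborel (ball (0::'a) (s j))) < emeasure lebesgue (E j)" for j
  proof -
    have "measure lborel (ball (0::'a) (s j)) < measure lborel (ball (0::'a) (r j))"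
      using s[of j] by (simp add: content_ball power_strict_mono)
    then show ?thesis
      by (intro less_le_trans[OF _ r[of j]]) (simp add: emeasure_eq_measure_bounded ennreal_less_iff)
  qed
  have "\<exists>K. compact K \<and> K \<subseteq> E j \<and> ennreal (measure lborel (ball (0::'a) (s j))) < emeasure lborel K \<and>
      (\<forall>x d. x \<in> K \<longrightarrow> d > 0 \<longrightarrow> emeasure lborel (K \<inter> ball x d) \<noteq> 0)" for j
    using compact_inner_approx_full_support[OF E sr, of j] by metis
  then obtain K where K: "\<And>j. compact (K j)" "\<And>j. K j \<subseteq> E j"
      "\<And>j. ennreal (measure lborel (ball (0::'a) (s j))) < emeasure lborel (K j)"
      "\<And>j x d. x \<in> K j \<Longrightarrow> d > 0 \<Longrightarrow> emeasure lborel (K j \<inter> ball x d) \<noteq> 0"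
    by metis
  have Kb: "K j \<in> sets borel" for j using K(1) by (simp add: compact_imp_closed)
  have "bounded (\<Union>j. K j)"
    using K(1) by (intro bounded_UN) (auto simp: compact_imp_bounded)
  then obtain R0 where R0: "(\<Union>j. K j) \<subseteq> ball 0 R0"
    using bounded_subset_ballD by blast
  define R where "R = max R0 (Max (range s))"
  have R: "s j \<le> R" "R0 \<le> R" for j
    by (auto simp: R_def intro: max.coboundedI2)
  have "\<bar>D y\<bar> \<le> c" if y: "\<And>j. y $ j \<in> K j" for y
  proof (rule ccontr)
    assume "\<not> ?thesis"
    then obtain d where d: "d > 0" "\<And>x. (\<And>j. x $ j \<in> ball (y $ j) d) \<Longrightarrow> c < \<bar>D x\<bar>"
      using continuous_gt_near[OF cont, of c y] by (auto simp: not_le)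
    \<comment> \<open>The bound fails throughout \<open>N\<close>, so \<open>N\<close> is null; yet
      it is a product of sets of positive measure.\<close>
    define N where "N = {x. \<forall>j. x $ j \<in> K j \<inter> ball (y $ j) d}"
    have N: "emeasure lborel N = (\<Prod>j\<in>UNIV. emeasure lborel (K j \<inter> ball (y $ j) d))"
      unfolding N_def by (rule emeasure_lborel_vec_Times) (use Kb in auto)
    have "AE x in lborel. (\<forall>j. x $ j \<in> E j) \<longrightarrow> \<bar>D x\<bar> \<le> c"
      using AE by (simp add: AE_completion_iff)
    then have "AE x in lborel. x \<notin> N"
    proof eventually_elim
      case (elim x)
      show ?case
      proof
        assume "x \<in> N"
        then have "\<forall>j. x $ j \<in> E j" "\<And>j. x $ j \<in> ball (y $ j) d"
          using K(2) by (auto simp: N_def)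
        with d(2)[of x] elim show False by auto
      qed
    qed
    then have "emeasure lborel N = 0"
      using AE_iff_null_sets[of N lborel] by (cases "N \<in> sets lborel") (auto simp: emeasure_notin_sets)
    with N have "\<exists>j. emeasure lborel (K j \<inter> ball (y $ j) d) = 0" by simp
    with K(4)[OF y d(1)] show False by simp
  qed
  then have "admissible D c R s K"
    unfolding admissible_def
    using R0 R(2) K(3) Kb K(1)
    by (auto simp: emeasure_eq_measure_bounded compact_imp_bounded ennreal_less_iff less_imp_le subset_eq
        intro: less_le_trans)
  then show ?thesis
    by (rule admissible_bound_balls[OF D cont]) (use R s in auto)
qed

section \<open>Rearrangements of functions\<close>

lemma exists_ball_emeasure_eq:
  fixes A :: "'a::euclidean_space set"
  assumes "emeasure lebesgue A < \<infinity>"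
  shows "\<exists>r\<ge>0. emeasure lebesgue (ball (0::'a) r) = emeasure lebesgue A"
proof -
  define m where "m = enn2real (emeasure lebesgue A)"
  define r where "r = root DIM('a) (m / unit_ball_vol DIM('a))"
  have "m \<ge> 0" by (simp add: m_def)
  have w: "unit_ball_vol (real DIM('a)) > 0" by simp
  have r: "r \<ge> 0" "r ^ DIM('a) = m / unit_ball_vol DIM('a)"
    using \<open>m \<ge> 0\<close> w by (simp_all add: r_def)
  have "emeasure lebesgue (ball (0::'a) r) = ennreal m"
    using r w by (simp add: emeasure_ball less_imp_neq[THEN not_sym])
  also have "\<dots> = emeasure lebesgue A"
    using assms by (simp add: m_def less_top)
  finally show ?thesis using r by blast
qed

lemma sym_set_eq_ball:
  fixes A :: "'a::euclidean_space set"
  assumes "emeasure lebesgue A < \<infinity>"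
  obtains r where "sym_set A = ball 0 r" "emeasure lebesgue (ball (0::'a) r) = emeasure lebesgue A"
  using someI_ex[OF exists_ball_emeasure_eq[OF assms]] that by (auto simp: sym_set_def)

lemma sym_rearr_antimono:
  assumes "norm x \<le> norm y"
  shows "sym_rearr f y \<le> sym_rearr f x"
  unfolding sym_rearr_def
  by (intro nn_integral_mono mult_right_mono) (use assms in \<open>auto simp: sym_set_def indicator_def\<close>)

text \<open>The rearrangement is an antitone function of the norm, and superlevel sets of an
  antitone function on the line are intervals.\<close>

lemma borel_measurable_sym_rearr [measurable]:
  fixes f :: "'a::euclidean_space \<Rightarrow> ennreal"
  shows "sym_rearr f \<in> borel_measurable borel"
proof -
  obtain e :: 'a where e: "norm e = 1"
    using nonempty_Basis norm_Basis by blast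
  \<comment> \<open>Clamping at 0 makes the radial profile along \<open>e\<close> antitone on the
    whole line.\<close>
  define h where "h t = sym_rearr f (max 0 t *\<^sub>R e)" for t
  have "antimono h"
    unfolding h_def using e by (intro antimonoI sym_rearr_antimono) (auto simp: max_def)
  have "h \<in> borel_measurable borel"
  proof (rule borel_measurableI_greater)
    fix y
    have "is_interval {t. y < h t}"
      unfolding is_interval_1 using \<open>antimono h\<close> by (auto dest: antimonoD intro: less_le_trans)
    then show "{t \<in> space borel. y < h t} \<in> sets borel"
      by (simp add: real_interval_borel_measurable)
  qed
  then have "(\<lambda>x :: 'a. h (norm x)) \<in> borel_measurable borel"
    by measurable
  moreover have "(\<lambda>x. h (norm x)) = sym_rearr f"
    unfolding h_def using e by (intro ext antisym sym_rearr_antimono) (simp_all add: max_absorb2)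
  ultimately show ?thesis by simp
qed

text \<open>Otherwise only levels in \<open>{0<..\<tau>}\<close> contribute to the integral defining
  \<open>sym_rearr\<close>, which is then at most \<open>\<tau>\<close>.\<close>

lemma less_sym_rearrD:
  assumes "ennreal \<tau> < sym_rearr f x" "\<tau> \<ge> 0"
  obtains t where "\<tau> < t" "x \<in> sym_set {y. ennreal t < f y}"
proof (rule ccontr)
  assume "\<not> thesis"
  with that have *: "x \<notin> sym_set {y. ennreal t < f y}" if "\<tau> < t" for t
    using that by blast
  have "sym_rearr f x \<le> (\<integral>\<^sup>+t. indicator {0<..\<tau>} t \<partial>(lborel :: real measure))"
    unfolding sym_rearr_def by (intro nn_integral_mono) (auto simp: indicator_def * not_le)
  also have "\<dots> = ennreal \<tau>" using assms(2) by simp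
  finally show False using assms(1) by simp
qed

lemma ennreal_mult_le_of_less:
  fixes x e M :: ennreal
  assumes "\<And>u. u < x \<Longrightarrow> u * e \<le> M"
  shows "x * e \<le> M"
proof -
  have "x \<le> (SUP u\<in>{..<x}. u)"
    by (rule dense_le) (auto intro: SUP_upper)
  then have "x * e \<le> (SUP u\<in>{..<x}. u) * e"
    by (rule mult_right_mono) simp
  also have "\<dots> = (SUP u\<in>{..<x}. u * e)"
    by (rule SUP_mult_right_ennreal)
  also have "\<dots> \<le> M"
    using assms by (intro SUP_least) auto
  finally show ?thesis .
qed

text \<open>Factors are approximated from below one at a time; \<open>e\<close> is generalized to
  absorb those already treated. This reduces rearranged values, possibly infinite, to finite levels
  strictly below them.\<close>

lemma ennreal_prod_le_of_less:
  fixes x :: "'m \<Rightarrow> ennreal"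
  assumes "finite J" "\<And>u. (\<And>j. j \<in> J \<Longrightarrow> u j < x j) \<Longrightarrow> (\<Prod>j\<in>J. u j) * e \<le> M"
  shows "(\<Prod>j\<in>J. x j) * e \<le> M"
  using assms
proof (induction J arbitrary: e rule: finite_induct)
  case (insert i J)
  have "x i * ((\<Prod>j\<in>J. x j) * e) \<le> M"
  proof (rule ennreal_mult_le_of_less)
    fix s assume s: "s < x i"
    have "(\<Prod>j\<in>J. x j) * (s * e) \<le> M"
    proof (rule insert.IH)
      fix u assume u: "\<And>j. j \<in> J \<Longrightarrow> u j < x j"
      have "(\<Prod>j\<in>insert i J. (u(i := s)) j) * e \<le> M"
        by (rule insert.prems) (use u s in auto)
      moreover have "(\<Prod>j\<in>J. (u(i := s)) j) = (\<Prod>j\<in>J. u j)"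
        by (rule prod.cong) (use insert.hyps in auto)
      ultimately show "(\<Prod>j\<in>J. u j) * (s * e) \<le> M"
        using insert.hyps by (simp add: ac_simps)
    qed
    then show "s * ((\<Prod>j\<in>J. x j) * e) \<le> M"
      by (simp add: ac_simps)
  qed
  then show ?case
    using insert.hyps by (simp add: ac_simps)
qed simp

text \<open>On the product of the superlevel sets at levels \<open>t j\<close>, the hypothesis
  bounds \<open>D\<close> by \<open>M\<close> divided by the product of the levels. This bound
  passes to the symmetrized superlevel sets, which contain the \<open>z $ j\<close>. An infinite
  \<open>M\<close> is trivial.\<close>

lemma sym_rearr_prod_le_AE_bound:
  fixes D :: "'a::euclidean_space^'m::finite \<Rightarrow> real" and f :: "'m \<Rightarrow> 'a \<Rightarrow> ennreal"
  assumes D: "line_linear D" and cont: "continuous_on UNIV D"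
    and f: "\<And>j. f j \<in> borel_measurable lebesgue" "\<And>j. vanishes_at_infinity (f j)"
    and AE: "AE z in lebesgue. (\<Prod>j\<in>UNIV. f j (z $ j)) * ennreal \<bar>D z\<bar> \<le> M"
  shows "(\<Prod>j\<in>UNIV. sym_rearr (f j) (z $ j)) * ennreal \<bar>D z\<bar> \<le> M"
proof (cases M)
  case (real m)
  show ?thesis
  proof (rule ennreal_prod_le_of_less)
    fix u assume u: "\<And>j. j \<in> UNIV \<Longrightarrow> u j < sym_rearr (f j) (z $ j)"
    define \<tau> where "\<tau> j = enn2real (u j)" for j
    have \<tau>: "u j = ennreal (\<tau> j)" "\<tau> j \<ge> 0" for j
      using less_le_trans[OF u[of j] top_greatest] by (simp_all add: \<tau>_def)
    have "\<exists>t>\<tau> j. z $ j \<in> sym_set {y. ennreal t < f j y}" for j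
      using u[of j] \<tau>[of j] less_sym_rearrD[of "\<tau> j" "f j" "z $ j"] by auto
    then obtain t where t: "\<And>j. \<tau> j < t j" "\<And>j. z $ j \<in> sym_set {y. ennreal (t j) < f j y}"
      by metis
    \<comment> \<open>\<open>\<tau> j\<close> may be 0, but the strictly larger \<open>t j\<close>
      is positive. This gives the superlevel set finite measure and permits division by the product
      \<open>T\<close>.\<close>
    have tpos: "t j > 0" for j using t(1) \<tau>(2) by (rule le_less_trans[rotated])
    define E where "E j = {y. ennreal (t j) < f j y}" for j
    have EL: "E j \<in> sets lebesgue" for j
    proof -
      have "{y \<in> space lebesgue. ennreal (t j) < f j y} \<in> sets lebesgue"
        using f(1)[of j] by measurable
      then show ?thesis by (simp add: E_def)
    qed
    have "emeasure lebesgue (E j) < \<infinity>" for j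
      using f(2)[of j] tpos by (auto simp: vanishes_at_infinity_def E_def)
    then have "\<exists>r. sym_set (E j) = ball 0 r \<and> emeasure lebesgue (ball (0::'a) r) = emeasure lebesgue (E j)" for j
      using sym_set_eq_ball by metis
    then obtain r where r: "\<And>j. sym_set (E j) = ball 0 (r j)"
        "\<And>j. emeasure lebesgue (ball (0::'a) (r j)) = emeasure lebesgue (E j)"
      by metis
    define T where "T = (\<Prod>j\<in>UNIV. t j)"
    have T: "T > 0" unfolding T_def by (intro prod_pos) (use tpos in auto)
    have AE': "AE y in lebesgue. (\<forall>j. y $ j \<in> E j) \<longrightarrow> \<bar>D y\<bar> \<le> m / T"
      using AE
    proof eventually_elim
      case (elim y)
      show ?case
      proof
        assume y: "\<forall>j. y $ j \<in> E j"
        have "ennreal T = (\<Prod>j\<in>UNIV. ennreal (t j))"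
          unfolding T_def using tpos by (simp add: prod_ennreal less_imp_le)
        also have "\<dots> \<le> (\<Prod>j\<in>UNIV. f j (y $ j))"
          using y by (intro prod_mono_ennreal) (auto simp: E_def less_imp_le)
        finally have "ennreal T * ennreal \<bar>D y\<bar> \<le> (\<Prod>j\<in>UNIV. f j (y $ j)) * ennreal \<bar>D y\<bar>"
          by (rule mult_right_mono) simp
        also have "\<dots> \<le> ennreal m" using elim real by simp
        finally have "T * \<bar>D y\<bar> \<le> m"
          using T real by (simp add: ennreal_mult[symmetric])
        then show "\<bar>D y\<bar> \<le> m / T" using T by (simp add: field_simps)
      qed
    qed
    have "emeasure lborel (ball (0::'a) (r j)) \<le> emeasure lebesgue (E j)" for j
      using r(2)[of j] by simp
    then have "\<bar>D z\<bar> \<le> m / T"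
      by (rule line_linear_AE_bound_balls[OF D cont EL _ AE']) (use t(2) r(1) in \<open>simp add: E_def\<close>)
    then have "T * \<bar>D z\<bar> \<le> m" using T by (simp add: field_simps)
    moreover have "(\<Prod>j\<in>UNIV. \<tau> j) * \<bar>D z\<bar> \<le> T * \<bar>D z\<bar>"
      unfolding T_def using t(1) \<tau>(2) by (intro mult_right_mono prod_mono) (auto simp: less_imp_le)
    ultimately have "(\<Prod>j\<in>UNIV. \<tau> j) * \<bar>D z\<bar> \<le> m" by simp
    then have "ennreal ((\<Prod>j\<in>UNIV. \<tau> j) * \<bar>D z\<bar>) \<le> ennreal m" by (rule ennreal_leI)
    then show "(\<Prod>j\<in>UNIV. u j) * ennreal \<bar>D z\<bar> \<le> M"
      using \<tau>(2) real by (simp add: \<tau>(1) prod_ennreal ennreal_mult prod_nonneg)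
  qed simp
qed simp

section \<open>Determinants and linear changes among the points\<close>

lemma line_linear_det: "line_linear (\<lambda>z :: (real^'n::finite)^'n. det (\<chi> k i. z $ i $ k))"
  unfolding line_linear_def
proof (intro allI impI)
  fix v :: "real^'n" and z :: "(real^'n)^'n"
  assume v: "norm v = 1"
  \<comment> \<open>Any coordinate will do. After rotating \<open>v\<close> to the coordinate vector
    \<open>axis k0 1\<close>, the components along \<open>v\<close> form row \<open>k0\<close> of
    the matrix, and the determinant is linear in that row.\<close>
  define k0 :: 'n where "k0 = undefined"
  obtain g :: "real^'n \<Rightarrow> real^'n" where g: "orthogonal_transformation g" "g v = axis k0 1"
    by (rule orthogonal_transformation_exists_1[OF v, of "axis k0 1"]) simp
  then have lin: "linear g" and "orthogonal_matrix (matrix g)"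
    by (simp_all add: orthogonal_transformation_matrix)
  \<comment> \<open>\<open>g\<close> may reverse orientation, so its determinant is 1 or -1; being
    its own inverse, it recovers the original determinant from the rotated one.\<close>
  then have sq: "det (matrix g) * det (matrix g) = 1"
    using det_orthogonal_matrix by fastforce
  have rot: "det (\<chi> k i. y $ i $ k) = det (matrix g) * det (\<chi> k i. g (y $ i) $ k)" for y :: "(real^'n)^'n"
  proof -
    have "matrix g ** (\<chi> k i. y $ i $ k) = (\<chi> k i. (matrix g *v (y $ i)) $ k)"
      by (simp add: matrix_matrix_mult_def matrix_vector_mult_def)
    also have "\<dots> = (\<chi> k i. g (y $ i) $ k)"
      using lin by (simp add: matrix_works)
    finally have "det (\<chi> k i. g (y $ i) $ k) = det (matrix g) * det (\<chi> k i. y $ i $ k)"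
      by (metis det_mul)
    with sq show ?thesis by (simp add: mult.assoc[symmetric])
  qed
  \<comment> \<open>Up to the sign from \<open>g\<close>, this is the cofactor at row
    \<open>k0\<close> and column \<open>j\<close>. It involves only the other rows, which are
    unchanged by shifts along \<open>v\<close>.\<close>
  define a where "a j = det (matrix g) *
    det (\<chi> k. if k = k0 then axis j 1 else (\<chi> i. g (z $ i) $ k) :: real^'n^'n)" for j
  have "det (\<chi> k i. (\<chi> j. z $ j + t j *\<^sub>R v) $ i $ k) = (\<Sum>j\<in>UNIV. a j * (z $ j \<bullet> v + t j))" for t
  proof -
    have row: "g (z $ i + t i *\<^sub>R v) $ k = (if k = k0 then z $ i \<bullet> v + t i else g (z $ i) $ k)" for i k
    proof -
      have "g (z $ i) $ k0 = g (z $ i) \<bullet> g v"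
        by (simp add: g inner_axis)
      also have "\<dots> = z $ i \<bullet> v"
        using g(1) by (simp add: orthogonal_transformation_def)
      finally show ?thesis
        using lin g by (simp add: linear_add linear_scale axis_def)
    qed
    have "(\<chi> k i. g (z $ i + t i *\<^sub>R v) $ k)
        = (\<chi> k. if k = k0 then (\<Sum>j\<in>UNIV. (z $ j \<bullet> v + t j) *s axis j 1) else (\<chi> i. g (z $ i) $ k) :: real^'n^'n)"
      by (auto simp: vec_eq_iff row axis_def if_distrib cong: if_cong)
    then have "det (\<chi> k i. g (z $ i + t i *\<^sub>R v) $ k)
        = (\<Sum>j\<in>UNIV. (z $ j \<bullet> v + t j) *
            det (\<chi> k. if k = k0 then axis j 1 else (\<chi> i. g (z $ i) $ k) :: real^'n^'n))"
      by (simp only: det_linear_row_sum[OF finite] det_row_mul)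
    then show ?thesis
      by (subst rot) (simp add: a_def sum_distrib_left ac_simps)
  qed
  then show "\<exists>a. \<forall>t. det (\<chi> k i. (\<chi> j. z $ j + t j *\<^sub>R v) $ i $ k) = (\<Sum>j\<in>UNIV. a j * (z $ j \<bullet> v + t j))"
    by blast
qed

text \<open>Shifting the points by multiples of \<open>v\<close> shifts each combination by the same
  combination of these multiples, so the coefficients transform by the transpose of
  \<open>C\<close>. This serves both the inverse of the change of variables and the differences in
  \<open>det1\<close>.\<close>

lemma line_linear_compose:
  fixes D :: "'a::euclidean_space^'p::finite \<Rightarrow> real" and C :: "'p \<Rightarrow> 'm::finite \<Rightarrow> real"
  assumes "line_linear D"
  shows "line_linear (\<lambda>z :: 'a^'m. D (\<chi> i. \<Sum>j\<in>UNIV. C i j *\<^sub>R z $ j))"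
  unfolding line_linear_def
proof (intro allI impI)
  fix v :: 'a and z :: "'a^'m"
  assume v: "norm v = 1"
  define y where "y = (\<chi> i. \<Sum>j\<in>UNIV. C i j *\<^sub>R z $ j)"
  obtain a where a: "\<And>t. D (\<chi> i. y $ i + t i *\<^sub>R v) = (\<Sum>i\<in>UNIV. a i * (y $ i \<bullet> v + t i))"
    using assms v unfolding line_linear_def by metis
  have "D (\<chi> i. \<Sum>j\<in>UNIV. C i j *\<^sub>R (\<chi> j. z $ j + t j *\<^sub>R v) $ j)
      = (\<Sum>j\<in>UNIV. (\<Sum>i\<in>UNIV. a i * C i j) * (z $ j \<bullet> v + t j))" for t
  proof -
    have "(\<chi> i. \<Sum>j\<in>UNIV. C i j *\<^sub>R (\<chi> j. z $ j + t j *\<^sub>R v) $ j)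
        = (\<chi> i. y $ i + (\<Sum>j\<in>UNIV. C i j * t j) *\<^sub>R v)"
      by (simp add: y_def scaleR_add_right sum.distrib scaleR_sum_left)
    then have "D (\<chi> i. \<Sum>j\<in>UNIV. C i j *\<^sub>R (\<chi> j. z $ j + t j *\<^sub>R v) $ j)
        = (\<Sum>i\<in>UNIV. a i * (y $ i \<bullet> v + (\<Sum>j\<in>UNIV. C i j * t j)))"
      by (simp only: a)
    also have "\<dots> = (\<Sum>i\<in>UNIV. \<Sum>j\<in>UNIV. a i * C i j * (z $ j \<bullet> v + t j))"
      by (simp add: y_def inner_sum_left sum.distrib[symmetric] sum_distrib_left algebra_simps)
    also have "\<dots> = (\<Sum>j\<in>UNIV. (\<Sum>i\<in>UNIV. a i * C i j) * (z $ j \<bullet> v + t j))"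
      by (subst sum.swap) (simp add: sum_distrib_right)
    finally show ?thesis .
  qed
  then show "\<exists>a. \<forall>t. D (\<chi> i. \<Sum>j\<in>UNIV. C i j *\<^sub>R (\<chi> j. z $ j + t j *\<^sub>R v) $ j)
      = (\<Sum>j\<in>UNIV. a j * (z $ j \<bullet> v + t j))"
    by (intro exI allI)
qed

lemma continuous_on_vec_sum:
  "continuous_on UNIV (\<lambda>z :: 'a::real_normed_vector^'m::finite. \<chi> i. \<Sum>j\<in>UNIV. C i j *\<^sub>R z $ j)"
  by (intro continuous_intros)

text \<open>Substituting \<open>z = L y\<close> turns the product into one of functions of separate
  variables and \<open>D\<close> into \<open>D\<close> composed with the inverse of
  \<open>L\<close>, which is again line-linear. The resulting bound holds at every point, hence
  bounds the essential supremum.\<close>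

lemma esssup_sym_rearr_prod_le:
  fixes D :: "'a::euclidean_space^'p::finite \<Rightarrow> real" and f :: "'p \<Rightarrow> 'a \<Rightarrow> ennreal" and A :: "real^'p^'p"
  assumes D: "line_linear D" and cont: "continuous_on UNIV D"
    and f: "\<And>j. f j \<in> borel_measurable lebesgue" "\<And>j. vanishes_at_infinity (f j)"
    and A: "invertible A"
  shows "esssup lebesgue (\<lambda>y. (\<Prod>j\<in>UNIV. sym_rearr (f j) (\<Sum>i\<in>UNIV. A $ i $ j *\<^sub>R y $ i)) * ennreal \<bar>D y\<bar>)
    \<le> esssup lebesgue (\<lambda>y. (\<Prod>j\<in>UNIV. f j (\<Sum>i\<in>UNIV. A $ i $ j *\<^sub>R y $ i)) * ennreal \<bar>D y\<bar>)"
    (is "_ \<le> ?M")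
proof -
  obtain C where C: "A ** C = mat 1" "C ** A = mat 1"
    using A by (auto simp: invertible_def)
  define L :: "'a^'p \<Rightarrow> 'a^'p" where "L y = (\<chi> j. \<Sum>i\<in>UNIV. A $ i $ j *\<^sub>R y $ i)" for y
  define L' :: "'a^'p \<Rightarrow> 'a^'p" where "L' z = (\<chi> i. \<Sum>j\<in>UNIV. C $ j $ i *\<^sub>R z $ j)" for z
  have inv: "(\<Sum>j\<in>UNIV. Q $ j $ i *\<^sub>R (\<Sum>k\<in>UNIV. P $ k $ j *\<^sub>R y $ k)) = y $ i"
    if "P ** Q = mat 1" for P Q :: "real^'p^'p" and y :: "'a^'p" and i
  proof -
    have "(\<Sum>j\<in>UNIV. Q $ j $ i *\<^sub>R (\<Sum>k\<in>UNIV. P $ k $ j *\<^sub>R y $ k))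
        = (\<Sum>k\<in>UNIV. (P ** Q) $ k $ i *\<^sub>R y $ k)"
      by (simp add: scaleR_sum_right matrix_matrix_mult_def scaleR_sum_left mult.commute, subst sum.swap) simp
    also have "\<dots> = (\<Sum>k\<in>UNIV. if k = i then y $ k else 0)"
      unfolding that by (intro sum.cong) (auto simp: mat_def)
    finally show ?thesis by simp
  qed
  have LL': "L (L' z) = z" for z
    by (simp add: L_def L'_def vec_eq_iff inv[OF C(2)])
  have L'L: "L' (L y) = y" for y
    by (simp add: L_def L'_def vec_eq_iff inv[OF C(1)])
  have D': "line_linear (\<lambda>z. D (L' z))"
    unfolding L'_def by (rule line_linear_compose[OF D])
  have cont': "continuous_on UNIV (\<lambda>z. D (L' z))"
    unfolding L'_def
    by (rule continuous_on_compose2[OF cont continuous_on_vec_sum]) simp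
  have "linear L"
    by (auto simp: L_def vec_eq_iff scaleR_add_right sum.distrib scaleR_sum_right intro!: linearI)
       (simp add: mult.commute)
  have "AE y in lebesgue. (\<Prod>j\<in>UNIV. f j (L y $ j)) * ennreal \<bar>D y\<bar> \<le> ?M"
    using esssup_AE[where f = "\<lambda>y. (\<Prod>j\<in>UNIV. f j (L y $ j)) * ennreal \<bar>D y\<bar>"] by (simp add: L_def)
  then obtain N where N: "negligible N" "{y. \<not> (\<Prod>j\<in>UNIV. f j (L y $ j)) * ennreal \<bar>D y\<bar> \<le> ?M} \<subseteq> N"
    unfolding eventually_ae_filter_negligible by blast
  \<comment> \<open>Only null sets have to be transported: the exceptional set for \<open>z\<close>
    lies in the image under \<open>L\<close> of the one for \<open>y\<close>, and a linear map of
    the space to itself preserves negligibility.\<close>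
  have "negligible (L ` N)"
    using \<open>linear L\<close> by (intro negligible_differentiable_image_negligible[OF _ N(1)] linear_imp_differentiable_on) auto
  moreover have "{z. \<not> (\<Prod>j\<in>UNIV. f j (z $ j)) * ennreal \<bar>D (L' z)\<bar> \<le> ?M} \<subseteq> L ` N"
  proof
    fix z assume "z \<in> {z. \<not> (\<Prod>j\<in>UNIV. f j (z $ j)) * ennreal \<bar>D (L' z)\<bar> \<le> ?M}"
    then have "L' z \<in> N" using N(2) by (auto simp: LL')
    then show "z \<in> L ` N" by (metis LL' image_eqI)
  qed
  ultimately have "AE z in lebesgue. (\<Prod>j\<in>UNIV. f j (z $ j)) * ennreal \<bar>D (L' z)\<bar> \<le> ?M"
    unfolding eventually_ae_filter_negligible by blast
  then have bound: "(\<Prod>j\<in>UNIV. sym_rearr (f j) (z $ j)) * ennreal \<bar>D (L' z)\<bar> \<le> ?M" for z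
    by (rule sym_rearr_prod_le_AE_bound[OF D' cont' f])
  have bound': "(\<Prod>j\<in>UNIV. sym_rearr (f j) (\<Sum>i\<in>UNIV. A $ i $ j *\<^sub>R y $ i)) * ennreal \<bar>D y\<bar> \<le> ?M" for y
    using bound[of "L y"] unfolding L'L by (simp add: L_def)
  \<comment> \<open>A nonmeasurable function has \<open>esssup\<close> equal to \<open>top\<close>,
    so the pointwise bound helps only once the rearranged product is known to be measurable.\<close>
  have [measurable]: "D \<in> borel_measurable borel"
    using cont by (rule borel_measurable_continuous_onI)
  have [measurable]: "(\<lambda>y :: 'a^'p. \<Sum>i\<in>UNIV. A $ i $ j *\<^sub>R y $ i) \<in> borel_measurable borel" for j
    by (intro borel_measurable_continuous_onI continuous_intros)
  have "(\<lambda>y. (\<Prod>j\<in>UNIV. sym_rearr (f j) (\<Sum>i\<in>UNIV. A $ i $ j *\<^sub>R y $ i)) * ennreal \<bar>D y\<bar>)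
      \<in> borel_measurable lborel"
    by measurable
  then have "(\<lambda>y. (\<Prod>j\<in>UNIV. sym_rearr (f j) (\<Sum>i\<in>UNIV. A $ i $ j *\<^sub>R y $ i)) * ennreal \<bar>D y\<bar>)
      \<in> borel_measurable lebesgue"
    by (rule measurable_completion)
  then show ?thesis
    by (rule esssup_I) (use bound' in simp)
qed

lemma continuous_on_det: "continuous_on UNIV (\<lambda>z :: (real^'n::finite)^'n. det (\<chi> k i. z $ i $ k))"
  unfolding det_def by (intro continuous_intros)

theorem theorem2p5:
  fixes f :: "'n::finite \<Rightarrow> real^'n \<Rightarrow> ennreal"
    and A :: "real^'n^'n"
    and g :: "'n option \<Rightarrow> real^'n \<Rightarrow> ennreal"
    and B :: "real^('n option)^('n option)"
  shows
   "((\<forall>j. f j \<in> borel_measurable lebesgue \<and> vanishes_at_infinity (f j)) \<and> invertible A \<longrightarrow>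
      esssup lebesgue (\<lambda>y::(real^'n)^'n.
         (\<Prod>j\<in>UNIV. sym_rearr (f j) (\<Sum>i\<in>UNIV. A $ i $ j *\<^sub>R y $ i)) * ennreal (det0 y))
      \<le> esssup lebesgue (\<lambda>y::(real^'n)^'n.
         (\<Prod>j\<in>UNIV. f j (\<Sum>i\<in>UNIV. A $ i $ j *\<^sub>R y $ i)) * ennreal (det0 y)))
    \<and>
    ((\<forall>j. g j \<in> borel_measurable lebesgue \<and> vanishes_at_infinity (g j)) \<and> invertible B \<longrightarrow>
      esssup lebesgue (\<lambda>y::(real^'n)^('n option).
         (\<Prod>j\<in>UNIV. sym_rearr (g j) (\<Sum>i\<in>UNIV. B $ i $ j *\<^sub>R y $ i)) * ennreal (det1 y))
      \<le> esssup lebesgue (\<lambda>y::(real^'n)^('n option).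
         (\<Prod>j\<in>UNIV. g j (\<Sum>i\<in>UNIV. B $ i $ j *\<^sub>R y $ i)) * ennreal (det1 y)))"
proof (intro conjI impI)
  assume "(\<forall>j. f j \<in> borel_measurable lebesgue \<and> vanishes_at_infinity (f j)) \<and> invertible A"
  then show "esssup lebesgue (\<lambda>y::(real^'n)^'n.
         (\<Prod>j\<in>UNIV. sym_rearr (f j) (\<Sum>i\<in>UNIV. A $ i $ j *\<^sub>R y $ i)) * ennreal (det0 y))
      \<le> esssup lebesgue (\<lambda>y::(real^'n)^'n.
         (\<Prod>j\<in>UNIV. f j (\<Sum>i\<in>UNIV. A $ i $ j *\<^sub>R y $ i)) * ennreal (det0 y))"
    unfolding det0_def
    by (intro esssup_sym_rearr_prod_le[OF line_linear_det continuous_on_det]) auto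
next
  assume *: "(\<forall>j. g j \<in> borel_measurable lebesgue \<and> vanishes_at_infinity (g j)) \<and> invertible B"
  \<comment> \<open>This matrix sends the \<open>n + 1\<close> points to their \<open>n\<close>
    differences with the point at \<open>None\<close>, which exhibits \<open>det1\<close> as the
    determinant form composed with a linear change among the points.\<close>
  define C :: "'n \<Rightarrow> 'n option \<Rightarrow> real"
    where "C i j = (if j = Some i then 1 else if j = None then - 1 else 0)" for i j
  have C: "(\<Sum>j\<in>UNIV. C i j *\<^sub>R y $ j) = y $ Some i - y $ None" for i and y :: "(real^'n)^('n option)"
  proof -
    have "(\<Sum>j\<in>UNIV. C i j *\<^sub>R y $ j) = (\<Sum>j\<in>{Some i, None}. C i j *\<^sub>R y $ j)"
      by (rule sum.mono_neutral_right) (auto simp: C_def)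
    then show ?thesis by (simp add: C_def)
  qed
  define D where "D y = det (\<chi> k i. (\<chi> i. \<Sum>j\<in>UNIV. C i j *\<^sub>R y $ j) $ i $ k :: real^'n^'n)"
    for y :: "(real^'n)^('n option)"
  have "det1 y = \<bar>D y\<bar>" for y
    by (simp add: det1_def D_def C)
  moreover have "line_linear D"
    unfolding D_def by (rule line_linear_compose[OF line_linear_det])
  moreover have "continuous_on UNIV D"
    unfolding D_def by (rule continuous_on_compose2[OF continuous_on_det continuous_on_vec_sum]) simp
  ultimately show "esssup lebesgue (\<lambda>y::(real^'n)^('n option).
         (\<Prod>j\<in>UNIV. sym_rearr (g j) (\<Sum>i\<in>UNIV. B $ i $ j *\<^sub>R y $ i)) * ennreal (det1 y))
      \<le> esssup lebesgue (\<lambda>y::(real^'n)^('n option).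
         (\<Prod>j\<in>UNIV. g j (\<Sum>i\<in>UNIV. B $ i $ j *\<^sub>R y $ i)) * ennreal (det1 y))"
    using esssup_sym_rearr_prod_le[of D g B] * by simp
qed

end
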